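(* Let $X$ be a measurable space and $\mathcal{M}$ be a Banach space of finite signed measures on $X$ with $\mathcal{M}\hookrightarrow\mathcal{M}(X)$. Moreover, let $k_1,k_2$ be measurable kernels on $X$ with RKHSs $H_1,H_2$, such that $\Psi:=k_1-k_2$ is bounded. Then the integral reproducing kernel Banach space $E_{\mathcal{M},\Psi,1}$ is a proper BSF. If, in addition, we have $$H_1,H_2\subset\mathcal{L}_1(\mu)$$ for all $\mu\in\mathcal{M}$, then the RKHS $H=H_1+H_2$ of the kernel $k:=k_1+k_2$ fulfils $$E_{\mathcal{M},\Psi,1}\hookrightarrow H .$$
   Context: A Banach space of functions (BSF) on a set $X\ne\emptyset$ is a Banach space whose elements are functions $X\to\mathbb{R}$; it is proper if all evaluation functionals $f\mapsto f(x)$, $x\in X$, are continuous on it. An RKHS on $X$ is a proper BSF with a Hilbert space norm; its kernel is $k(x,x')=\langle\delta_x,\delta_{x'}\rangle_{H'}$ with $\delta_x$ the evaluation functional at $x$. A kernel on $X$ is a symmetric positive semi-definite function $X\times X\to\mathbb{R}$ (equivalently, the kernel of a unique RKHS). $\mathcal{M}(X)$ is the space of finite signed measures on $X$ with the total variation norm. A Banach space $\mathcal{M}$ of finite signed measures on $X$ is a linear space of finite signed measures equipped with a complete norm $\|\cdot\|_{\mathcal{M}}$. $E\hookrightarrow F$ means $E\subset F$ with continuous inclusion map. $\mathcal{L}_1(\mu)$ is the set of measurable functions $X\to\mathbb{R}$ that are integrable with respect to the total variation of $\mu$. For a measurable $\Psi:X\times X\to\mathbb{R}$ with $\sup_{y\in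 X}|\Psi(x,y)|<\infty$ for all $x\in X$, define for $\mu\in\mathcal{M}$ the function $f_\mu(x):=\int_X\Psi(x,y)\,d\mu(y)$, $x\in X$. The integral reproducing kernel Banach space is $E_{\mathcal{M},\Psi,1}:=\{f_\mu:\mu\in\mathcal{M}\}$ with the norm $\|f_\mu\|_{E_{\mathcal{M},\Psi,1}}:=\inf\{\|\nu\|_{\mathcal{M}}:\nu\in\mathcal{M},\ f_\nu=f_\mu\}$. *)

theory Defs
  imports "HOL-Analysis.Analysis"
begin

section \<open>Normed spaces of real-valued functions\<close>

text \<open>
  A function \<open>I \<rightarrow> \<real>\<close> on a set \<open>I\<close> is represented by its extension by zero, so that equality of
  HOL functions is equality on \<open>I\<close>. Spaces of such functions are given by a carrier \<open>V\<close> and a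
  norm \<open>N\<close>, whose values outside of \<open>V\<close> are irrelevant. The index set is the underlying set \<open>X\<close>
  for spaces of functions on \<open>X\<close>, and the \<open>\<sigma>\<close>-algebra for spaces of signed measures.
\<close>

definition functions_on :: "'i set \<Rightarrow> ('i \<Rightarrow> real) set" where
  "functions_on I = {f. \<forall>x. x \<notin> I \<longrightarrow> f x = 0}"

definition function_space :: "'i set \<Rightarrow> ('i \<Rightarrow> real) set \<Rightarrow> bool" where
  "function_space I V \<longleftrightarrow>
     V \<subseteq> functions_on I \<and>
     (\<lambda>x. 0) \<in> V \<and>
     (\<forall>f\<in>V. \<forall>g\<in>V. (\<lambda>x. f x + g x) \<in> V) \<and>
     (\<forall>c. \<forall>f\<in>V. (\<lambda>x. c * f x) \<in> V)"

definition is_norm_on :: "('i \<Rightarrow> real) set \<Rightarrow> (('i \<Rightarrow> real) \<Rightarrow> real) \<Rightarrow> bool" where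
  "is_norm_on V N \<longleftrightarrow>
     (\<forall>f\<in>V. 0 \<le> N f) \<and>
     (\<forall>f\<in>V. N f = 0 \<longleftrightarrow> f = (\<lambda>x. 0)) \<and>
     (\<forall>c. \<forall>f\<in>V. N (\<lambda>x. c * f x) = \<bar>c\<bar> * N f) \<and>
     (\<forall>f\<in>V. \<forall>g\<in>V. N (\<lambda>x. f x + g x) \<le> N f + N g)"

definition ndist :: "(('i \<Rightarrow> real) \<Rightarrow> real) \<Rightarrow> ('i \<Rightarrow> real) \<Rightarrow> ('i \<Rightarrow> real) \<Rightarrow> real" where
  "ndist N f g = N (\<lambda>x. f x - g x)"

definition complete_norm_on :: "('i \<Rightarrow> real) set \<Rightarrow> (('i \<Rightarrow> real) \<Rightarrow> real) \<Rightarrow> bool" where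
  "complete_norm_on V N \<longleftrightarrow>
     (\<forall>s::nat \<Rightarrow> 'i \<Rightarrow> real.
        range s \<subseteq> V \<and> (\<forall>e>0. \<exists>n0. \<forall>m\<ge>n0. \<forall>n\<ge>n0. ndist N (s m) (s n) < e) \<longrightarrow>
        (\<exists>f\<in>V. (\<lambda>n. ndist N (s n) f) \<longlonglongrightarrow> 0))"

definition banach_function_space ::
  "'i set \<Rightarrow> ('i \<Rightarrow> real) set \<Rightarrow> (('i \<Rightarrow> real) \<Rightarrow> real) \<Rightarrow> bool" where
  "banach_function_space I V N \<longleftrightarrow>
     function_space I V \<and> is_norm_on V N \<and> complete_norm_on V N"

definition continuously_embedded ::
  "('i \<Rightarrow> real) set \<Rightarrow> (('i \<Rightarrow> real) \<Rightarrow> real) \<Rightarrow>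
   ('i \<Rightarrow> real) set \<Rightarrow> (('i \<Rightarrow> real) \<Rightarrow> real) \<Rightarrow> bool" where
  "continuously_embedded E NE F NF \<longleftrightarrow>
     E \<subseteq> F \<and>
     (\<forall>f\<in>E. \<forall>e>0. \<exists>d>0. \<forall>g\<in>E. ndist NE g f < d \<longrightarrow> ndist NF g f < e)"


section \<open>Proper Banach spaces of functions and reproducing kernel Hilbert spaces\<close>

definition bsf :: "'a set \<Rightarrow> ('a \<Rightarrow> real) set \<Rightarrow> (('a \<Rightarrow> real) \<Rightarrow> real) \<Rightarrow> bool" where
  "bsf X E N \<longleftrightarrow> X \<noteq> {} \<and> banach_function_space X E N"

definition proper_bsf :: "'a set \<Rightarrow> ('a \<Rightarrow> real) set \<Rightarrow> (('a \<Rightarrow> real) \<Rightarrow> real) \<Rightarrow> bool" where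
  "proper_bsf X E N \<longleftrightarrow>
     bsf X E N \<and>
     (\<forall>x\<in>X. \<forall>f\<in>E. \<forall>e>0. \<exists>d>0. \<forall>g\<in>E. ndist N g f < d \<longrightarrow> \<bar>g x - f x\<bar> < e)"

definition hilbert_norm_on :: "('i \<Rightarrow> real) set \<Rightarrow> (('i \<Rightarrow> real) \<Rightarrow> real) \<Rightarrow> bool" where
  "hilbert_norm_on V N \<longleftrightarrow>
     (\<exists>ip :: ('i \<Rightarrow> real) \<Rightarrow> ('i \<Rightarrow> real) \<Rightarrow> real.
        (\<forall>f\<in>V. \<forall>g\<in>V. ip f g = ip g f) \<and>
        (\<forall>f\<in>V. \<forall>g\<in>V. \<forall>h\<in>V. ip (\<lambda>x. f x + g x) h = ip f h + ip g h) \<and>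
        (\<forall>c. \<forall>f\<in>V. \<forall>g\<in>V. ip (\<lambda>x. c * f x) g = c * ip f g) \<and>
        (\<forall>f\<in>V. 0 \<le> ip f f \<and> N f = sqrt (ip f f)))"

definition rkhs :: "'a set \<Rightarrow> ('a \<Rightarrow> real) set \<Rightarrow> (('a \<Rightarrow> real) \<Rightarrow> real) \<Rightarrow> bool" where
  "rkhs X H N \<longleftrightarrow> proper_bsf X H N \<and> hilbert_norm_on H N"

definition dual_norm ::
  "('i \<Rightarrow> real) set \<Rightarrow> (('i \<Rightarrow> real) \<Rightarrow> real) \<Rightarrow> (('i \<Rightarrow> real) \<Rightarrow> real) \<Rightarrow> real" where
  "dual_norm V N \<phi> = (SUP f\<in>{f\<in>V. N f \<le> 1}. \<bar>\<phi> f\<bar>)"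

text \<open>The inner product of the dual of a Hilbert space, recovered from the dual norm by polarization.\<close>

definition dual_inner ::
  "('i \<Rightarrow> real) set \<Rightarrow> (('i \<Rightarrow> real) \<Rightarrow> real) \<Rightarrow>
   (('i \<Rightarrow> real) \<Rightarrow> real) \<Rightarrow> (('i \<Rightarrow> real) \<Rightarrow> real) \<Rightarrow> real" where
  "dual_inner V N \<phi> \<psi> =
     ((dual_norm V N (\<lambda>f. \<phi> f + \<psi> f))\<^sup>2 - (dual_norm V N (\<lambda>f. \<phi> f - \<psi> f))\<^sup>2) / 4"

definition rkhs_kernel ::
  "('a \<Rightarrow> real) set \<Rightarrow> (('a \<Rightarrow> real) \<Rightarrow> real) \<Rightarrow> 'a \<Rightarrow> 'a \<Rightarrow> real" where
  "rkhs_kernel H N x x' = dual_inner H N (\<lambda>f. f x) (\<lambda>f. f x')"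

definition rkhs_of_kernel ::
  "'a set \<Rightarrow> ('a \<Rightarrow> 'a \<Rightarrow> real) \<Rightarrow> ('a \<Rightarrow> real) set \<Rightarrow> (('a \<Rightarrow> real) \<Rightarrow> real) \<Rightarrow> bool" where
  "rkhs_of_kernel X k H N \<longleftrightarrow>
     rkhs X H N \<and> (\<forall>x\<in>X. \<forall>x'\<in>X. k x x' = rkhs_kernel H N x x')"

definition kernel_on :: "'a set \<Rightarrow> ('a \<Rightarrow> 'a \<Rightarrow> real) \<Rightarrow> bool" where
  "kernel_on X k \<longleftrightarrow>
     (\<forall>x\<in>X. \<forall>x'\<in>X. k x x' = k x' x) \<and>
     (\<forall>(n::nat) (c::nat \<Rightarrow> real) (x::nat \<Rightarrow> 'a).
        (\<forall>i<n. x i \<in> X) \<longrightarrow> 0 \<le> (\<Sum>i<n. \<Sum>j<n. c i * c j * k (x i) (x j)))"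

definition measurable_kernel :: "'a measure \<Rightarrow> ('a \<Rightarrow> 'a \<Rightarrow> real) \<Rightarrow> bool" where
  "measurable_kernel X k \<longleftrightarrow>
     kernel_on (space X) k \<and> (\<lambda>(x, y). k x y) \<in> borel_measurable (X \<Otimes>\<^sub>M X)"

definition function_set_sum ::
  "('a \<Rightarrow> real) set \<Rightarrow> ('a \<Rightarrow> real) set \<Rightarrow> ('a \<Rightarrow> real) set" where
  "function_set_sum F G = {(\<lambda>x. f x + g x) | f g. f \<in> F \<and> g \<in> G}"


section \<open>Finite signed measures\<close>

text \<open>
  A measurable space is a value \<open>X\<close> of type \<open>'a measure\<close>, of which only \<open>space X\<close> and \<open>sets X\<close>
  are used.
\<close>

definition finite_signed_measures :: "'a measure \<Rightarrow> ('a set \<Rightarrow> real) set" where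
  "finite_signed_measures X =
     {\<mu> \<in> functions_on (sets X).
        \<forall>A::nat \<Rightarrow> 'a set. range A \<subseteq> sets X \<and> disjoint_family A \<longrightarrow>
          (\<lambda>n. \<mu> (A n)) sums \<mu> (\<Union>n. A n)}"

text \<open>
  The positive part of the Jordan decomposition. Since \<open>ennreal\<close> maps negative reals to \<open>0\<close> and
  \<open>B = {}\<close> is admissible, the supremum is that of the values \<open>\<mu> B\<close>. The supremum is indeed
  countably additive, see \<open>emeasure_positive_variation\<close> below.
\<close>

definition positive_variation :: "'a measure \<Rightarrow> ('a set \<Rightarrow> real) \<Rightarrow> 'a measure" where
  "positive_variation X \<mu> =
     measure_of (space X) (sets X) (\<lambda>A. SUP B\<in>{B\<in>sets X. B \<subseteq> A}. ennreal (\<mu> B))"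

definition negative_variation :: "'a measure \<Rightarrow> ('a set \<Rightarrow> real) \<Rightarrow> 'a measure" where
  "negative_variation X \<mu> = positive_variation X (\<lambda>A. - \<mu> A)"

definition total_variation :: "'a measure \<Rightarrow> ('a set \<Rightarrow> real) \<Rightarrow> 'a measure" where
  "total_variation X \<mu> =
     measure_of (space X) (sets X)
       (\<lambda>A. emeasure (positive_variation X \<mu>) A + emeasure (negative_variation X \<mu>) A)"

definition total_variation_norm :: "'a measure \<Rightarrow> ('a set \<Rightarrow> real) \<Rightarrow> real" where
  "total_variation_norm X \<mu> = measure (total_variation X \<mu>) (space X)"

definition signed_integral :: "'a measure \<Rightarrow> ('a set \<Rightarrow> real) \<Rightarrow> ('a \<Rightarrow> real) \<Rightarrow> real" where
  "signed_integral X \<mu> g =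
     (\<integral>y. g y \<partial>positive_variation X \<mu>) - (\<integral>y. g y \<partial>negative_variation X \<mu>)"

definition L1_functions :: "'a measure \<Rightarrow> ('a set \<Rightarrow> real) \<Rightarrow> ('a \<Rightarrow> real) set" where
  "L1_functions X \<mu> = {f \<in> functions_on (space X). integrable (total_variation X \<mu>) f}"

definition banach_space_of_signed_measures ::
  "'a measure \<Rightarrow> ('a set \<Rightarrow> real) set \<Rightarrow> (('a set \<Rightarrow> real) \<Rightarrow> real) \<Rightarrow> bool" where
  "banach_space_of_signed_measures X MM NM \<longleftrightarrow>
     MM \<subseteq> finite_signed_measures X \<and> banach_function_space (sets X) MM NM"

lemma finite_signed_measuresD:
  fixes A :: "nat \<Rightarrow> 'a set"
  assumes "\<mu> \<in> finite_signed_measures X" "range A \<subseteq> sets X" "disjoint_family A"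
  shows "(\<lambda>n. \<mu> (A n)) sums \<mu> (\<Union>n. A n)"
  using assms unfolding finite_signed_measures_def by blast

lemma finite_signed_measures_empty:
  assumes "\<mu> \<in> finite_signed_measures X"
  shows "\<mu> {} = 0"
proof -
  have "(\<lambda>n::nat. \<mu> {}) sums \<mu> (\<Union>n::nat. {})"
    using assms unfolding finite_signed_measures_def
    by (auto simp: disjoint_family_on_def dest: spec[where x = "\<lambda>n::nat. {}"])
  then have "summable (\<lambda>n::nat. \<mu> {})"
    by (rule sums_summable)
  then show ?thesis
    by (simp add: summable_const_iff)
qed

lemma finite_signed_measures_Un:
  assumes \<mu>: "\<mu> \<in> finite_signed_measures X"
    and AB: "A \<in> sets X" "B \<in> sets X" "A \<inter> B = {}"
  shows "\<mu> (A \<union> B) = \<mu> A + \<mu> B"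
proof -
  have "range (binaryset A B) \<subseteq> sets X"
    using AB by (auto simp: range_binaryset_eq)
  moreover have "disjoint_family (binaryset A B)"
    using AB by (auto simp: disjoint_family_on_def binaryset_def)
  ultimately have "(\<lambda>n. \<mu> (binaryset A B n)) sums \<mu> (\<Union>n. binaryset A B n)"
    using \<mu> unfolding finite_signed_measures_def by blast
  moreover have "(\<lambda>n. \<mu> (binaryset A B n)) sums (\<mu> A + \<mu> B)"
    using binaryset_sums[of \<mu> A B] finite_signed_measures_empty[OF \<mu>] by simp
  ultimately show ?thesis
    by (metis UN_binaryset_eq sums_unique2)
qed

lemma emeasure_positive_variation:
  assumes \<mu>: "\<mu> \<in> finite_signed_measures X" and A: "A \<in> sets X"
  shows "emeasure (positive_variation X \<mu>) A = (SUP B\<in>{B\<in>sets X. B \<subseteq> A}. ennreal (\<mu> B))"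
proof -
  define v where "v A = (SUP B\<in>{B\<in>sets X. B \<subseteq> A}. ennreal (\<mu> B))" for A
  note empty = finite_signed_measures_empty[OF \<mu>]
  have upper: "ennreal (\<mu> B) \<le> v A" if "B \<in> sets X" "B \<subseteq> A" for A B
    unfolding v_def using that by (intro SUP_upper) auto
  have mono: "v A \<le> v B" if "A \<subseteq> B" for A B
    unfolding v_def using that by (intro SUP_subset_mono) auto
  have pos_set: "\<exists>C\<in>sets X. C \<subseteq> B \<and> 0 \<le> \<mu> C \<and> ennreal (\<mu> C) = ennreal (\<mu> B)"
    if "B \<in> sets X" for B
  proof (cases "0 \<le> \<mu> B")
    case False
    then show ?thesis
      using empty by (intro bexI[of _ "{}"]) (auto simp: ennreal_neg)
  qed (use that in auto)
  have two: "ennreal (\<mu> C) + ennreal (\<mu> D) \<le> v (A \<union> B)"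
    if H: "A \<inter> B = {}" "C \<in> sets X" "C \<subseteq> A" "D \<in> sets X" "D \<subseteq> B" for A B C D
  proof -
    obtain C' where C': "C' \<in> sets X" "C' \<subseteq> C" "0 \<le> \<mu> C'" "ennreal (\<mu> C') = ennreal (\<mu> C)"
      using pos_set[OF H(2)] by auto
    obtain D' where D': "D' \<in> sets X" "D' \<subseteq> D" "0 \<le> \<mu> D'" "ennreal (\<mu> D') = ennreal (\<mu> D)"
      using pos_set[OF H(4)] by auto
    have "C' \<inter> D' = {}"
      using H C' D' by blast
    then have "\<mu> (C' \<union> D') = \<mu> C' + \<mu> D'"
      using C' D' by (intro finite_signed_measures_Un[OF \<mu>]) auto
    then have "ennreal (\<mu> C) + ennreal (\<mu> D) = ennreal (\<mu> (C' \<union> D'))"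
      using C' D' ennreal_plus[OF C'(3) D'(3)] by simp
    also have "\<dots> \<le> v (A \<union> B)"
      using H C' D' by (intro upper) auto
    finally show ?thesis .
  qed
  have super: "v A + v B \<le> v (A \<union> B)" if AB: "A \<inter> B = {}" for A B
  proof -
    have ne: "{C \<in> sets X. C \<subseteq> S} \<noteq> {}" for S
      by auto
    have "v A + v B = (SUP C\<in>{C\<in>sets X. C \<subseteq> A}. ennreal (\<mu> C) + v B)"
      unfolding v_def using ne by (subst ennreal_SUP_add_left) auto
    also have "\<dots> \<le> v (A \<union> B)"
    proof (rule SUP_least)
      fix C assume C: "C \<in> {C \<in> sets X. C \<subseteq> A}"
      have "ennreal (\<mu> C) + v B = (SUP D\<in>{D\<in>sets X. D \<subseteq> B}. ennreal (\<mu> C) + ennreal (\<mu> D))"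
        unfolding v_def using ne by (subst ennreal_SUP_add_right) auto
      also have "\<dots> \<le> v (A \<union> B)"
        using AB C by (intro SUP_least two) auto
      finally show "ennreal (\<mu> C) + v B \<le> v (A \<union> B)" .
    qed
    finally show ?thesis .
  qed
  have "positive (sets X) v"
  proof -
    have "{B \<in> sets X. B \<subseteq> {}} = {{}}"
      by auto
    then show ?thesis
      unfolding positive_def v_def by (simp add: empty)
  qed
  moreover have "countably_additive (sets X) v"
  proof (rule countably_additiveI)
    fix A :: "nat \<Rightarrow> 'a set"
    assume A: "range A \<subseteq> sets X" "disjoint_family A" and U: "(\<Union>i. A i) \<in> sets X"
    show "(\<Sum>i. v (A i)) = v (\<Union>i. A i)"
    proof (rule antisym)
      have "(\<Sum>i<n. v (A i)) \<le> v (\<Union>i<n. A i)" for n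
      proof (induction n)
        case (Suc n)
        have disj: "(\<Union>i<n. A i) \<inter> A n = {}"
        proof -
          have "A i \<inter> A n = {}" if "i < n" for i
            using that disjoint_family_onD[OF A(2), of i n] by simp
          then show ?thesis
            by blast
        qed
        have "(\<Sum>i<Suc n. v (A i)) \<le> v (\<Union>i<n. A i) + v (A n)"
          using Suc by (simp add: add_right_mono)
        also have "\<dots> \<le> v ((\<Union>i<n. A i) \<union> A n)"
          by (rule super[OF disj])
        also have "(\<Union>i<n. A i) \<union> A n = (\<Union>i<Suc n. A i)"
          by (auto simp: less_Suc_eq)
        finally show ?case .
      qed simp
      moreover have "v (\<Union>i<n. A i) \<le> v (\<Union>i. A i)" for n
        by (rule mono) auto
      ultimately have "(\<Sum>i<n. v (A i)) \<le> v (\<Union>i. A i)" for n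
        using order_trans by blast
      then show "(\<Sum>i. v (A i)) \<le> v (\<Union>i. A i)"
        by (intro suminf_le_const) auto
    next
      have "ennreal (\<mu> B) \<le> (\<Sum>i. v (A i))" if B: "B \<in> sets X" "B \<subseteq> (\<Union>i. A i)" for B
      proof -
        have sB: "B \<inter> A i \<in> sets X" for i
          using A B by auto
        have "disjoint_family (\<lambda>i. B \<inter> A i)"
          using A(2) unfolding disjoint_family_on_def by blast
        then have "(\<lambda>i. \<mu> (B \<inter> A i)) sums \<mu> (\<Union>i. B \<inter> A i)"
          using sB by (intro finite_signed_measuresD[OF \<mu>]) auto
        moreover have "(\<Union>i. B \<inter> A i) = B"
          using B by blast
        ultimately have lim: "(\<lambda>n. ennreal (\<Sum>i<n. \<mu> (B \<inter> A i))) \<longlonglongrightarrow> ennreal (\<mu> B)"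
          unfolding sums_def by (auto intro!: tendsto_ennrealI)
        have "ennreal (\<Sum>i<n. \<mu> (B \<inter> A i)) \<le> (\<Sum>i. v (A i))" for n
        proof -
          have "ennreal (\<Sum>i<n. \<mu> (B \<inter> A i)) \<le> ennreal (\<Sum>i<n. max 0 (\<mu> (B \<inter> A i)))"
            by (intro ennreal_leI sum_mono) auto
          also have "\<dots> = (\<Sum>i<n. ennreal (max 0 (\<mu> (B \<inter> A i))))"
            by (rule sum_ennreal[symmetric]) auto
          also have "\<dots> = (\<Sum>i<n. ennreal (\<mu> (B \<inter> A i)))"
            by (intro sum.cong) (auto simp: max_def ennreal_neg)
          also have "\<dots> \<le> (\<Sum>i<n. v (A i))"
            using sB by (intro sum_mono upper) auto
          also have "\<dots> \<le> (\<Sum>i. v (A i))"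
            by (rule sum_le_suminf) auto
          finally show ?thesis .
        qed
        with lim show ?thesis
          by (intro LIMSEQ_le_const2[OF lim]) auto
      qed
      then show "v (\<Union>i. A i) \<le> (\<Sum>i. v (A i))"
        unfolding v_def[of "\<Union>i. A i"] by (intro SUP_least) auto
    qed
  qed
  ultimately have "emeasure (measure_of (space X) (sets X) v) A = v A"
    using A by (intro emeasure_measure_of_sigma sets.sigma_algebra_axioms)
  then show ?thesis
    unfolding positive_variation_def v_def .
qed


section \<open>Integral reproducing kernel Banach spaces\<close>

definition integral_function ::
  "'a measure \<Rightarrow> ('a \<Rightarrow> 'a \<Rightarrow> real) \<Rightarrow> ('a set \<Rightarrow> real) \<Rightarrow> 'a \<Rightarrow> real" where
  "integral_function X \<Psi> \<mu> x = (if x \<in> space X then signed_integral X \<mu> (\<lambda>y. \<Psi> x y) else 0)"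

definition integral_rkbs ::
  "'a measure \<Rightarrow> ('a set \<Rightarrow> real) set \<Rightarrow> ('a \<Rightarrow> 'a \<Rightarrow> real) \<Rightarrow> ('a \<Rightarrow> real) set" where
  "integral_rkbs X MM \<Psi> = {integral_function X \<Psi> \<mu> | \<mu>. \<mu> \<in> MM}"

definition integral_rkbs_norm ::
  "'a measure \<Rightarrow> ('a set \<Rightarrow> real) set \<Rightarrow> (('a set \<Rightarrow> real) \<Rightarrow> real) \<Rightarrow>
   ('a \<Rightarrow> 'a \<Rightarrow> real) \<Rightarrow> ('a \<Rightarrow> real) \<Rightarrow> real" where
  "integral_rkbs_norm X MM NM \<Psi> f = Inf {NM \<nu> | \<nu>. \<nu> \<in> MM \<and> integral_function X \<Psi> \<nu> = f}"

end

theory Submission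
  imports Defs
begin

text \<open>
  The space \<open>E\<close> of the functions \<open>f\<^sub>\<mu>\<close> is the image of a Banach space of measures under the linear map
  \<open>\<mu> \<mapsto> f\<^sub>\<mu>\<close>. Since \<open>\<Psi>\<close> is bounded and \<open>MM \<hookrightarrow> M(X)\<close>, the bound \<open>\<bar>f\<^sub>\<mu> x\<bar> \<le> B \<parallel>\<mu>\<parallel>\<^sub>T\<^sub>V \<le> B C \<parallel>\<mu>\<parallel>\<close> makes
  every evaluation of this map continuous. Such an image is a proper Banach space of functions under
  its quotient norm (\<open>proper_bsf_image\<close>, \<open>proper_bsf_integral_rkbs\<close>). Linearity of signed integrals in
  the measure needs the Jordan decomposition and its finiteness.

  For the embedding, let all functions in \<open>H\<^sub>1\<close> be integrable with respect to \<open>\<mu>\<close>. By uniform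
  boundedness, integration against \<open>\<mu>\<close> is then a continuous functional on \<open>H\<^sub>1\<close>
  (\<open>integral_abs_le_norm\<close>), represented by some \<open>g\<^sub>1 \<in> H\<^sub>1\<close>, and testing with kernel sections gives
  \<open>g\<^sub>1 x = \<integral> k\<^sub>1 x y d\<mu>(y)\<close> (\<open>kernel_mean_mem\<close>). With \<open>g\<^sub>2\<close> obtained in the same way from \<open>H\<^sub>2\<close>,
  \<open>f\<^sub>\<mu> = g\<^sub>1 - g\<^sub>2\<close> lies in \<open>H\<^sub>1 + H\<^sub>2\<close>. The continuity of the inclusion is automatic: a proper Banach
  space of functions contained in a reproducing kernel Hilbert space is continuously embedded into it,
  again by uniform boundedness (\<open>proper_bsf_subset_embedding\<close>).

  It remains to identify the reproducing kernel Hilbert space of \<open>k\<^sub>1 + k\<^sub>2\<close>. The image of the Hilbert sum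
  of \<open>H\<^sub>1\<close> and \<open>H\<^sub>2\<close> under addition has this kernel (\<open>rkhs_of_sum_of_kernels\<close>), and a kernel belongs to
  only one space of functions (\<open>rkhs_kernel_determines\<close>). The kernel being defined through the norm of
  the dual space, the Riesz representation theorem translates between it and the reproducing property.
\<close>

section \<open>Banach spaces of functions\<close>

locale banach_functions =
  fixes I :: "'i set" and V :: "('i \<Rightarrow> real) set" and N :: "('i \<Rightarrow> real) \<Rightarrow> real"
  assumes banach: "banach_function_space I V N"
begin

lemma outside: "f \<in> V \<Longrightarrow> x \<notin> I \<Longrightarrow> f x = 0"
  using banach unfolding banach_function_space_def function_space_def functions_on_def by blast

lemma zero_mem [simp, intro]: "(\<lambda>x. 0) \<in> V"
  using banach unfolding banach_function_space_def function_space_def by blast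

lemma add_mem [intro]: "f \<in> V \<Longrightarrow> g \<in> V \<Longrightarrow> (\<lambda>x. f x + g x) \<in> V"
  using banach unfolding banach_function_space_def function_space_def by blast

lemma scale_mem [intro]: "f \<in> V \<Longrightarrow> (\<lambda>x. c * f x) \<in> V"
  using banach unfolding banach_function_space_def function_space_def by blast

lemma minus_mem [intro]: "f \<in> V \<Longrightarrow> (\<lambda>x. - f x) \<in> V"
  using scale_mem[of f "-1"] by simp

lemma diff_mem [intro]: "f \<in> V \<Longrightarrow> g \<in> V \<Longrightarrow> (\<lambda>x. f x - g x) \<in> V"
  using add_mem[of f "\<lambda>x. - g x"] minus_mem[of g] by simp

lemma norm_nonneg: "f \<in> V \<Longrightarrow> 0 \<le> N f"
  using banach unfolding banach_function_space_def is_norm_on_def by blast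

lemma norm_eq_zero: "f \<in> V \<Longrightarrow> N f = 0 \<longleftrightarrow> f = (\<lambda>x. 0)"
  using banach unfolding banach_function_space_def is_norm_on_def by blast

lemma norm_zero [simp]: "N (\<lambda>x. 0) = 0"
  using norm_eq_zero by blast

lemma norm_scale: "f \<in> V \<Longrightarrow> N (\<lambda>x. c * f x) = \<bar>c\<bar> * N f"
  using banach unfolding banach_function_space_def is_norm_on_def by blast

lemma norm_triangle: "f \<in> V \<Longrightarrow> g \<in> V \<Longrightarrow> N (\<lambda>x. f x + g x) \<le> N f + N g"
  using banach unfolding banach_function_space_def is_norm_on_def by blast

lemma norm_minus: "f \<in> V \<Longrightarrow> N (\<lambda>x. - f x) = N f"
  using norm_scale[of f "-1"] by simp

lemma norm_diff_commute: "f \<in> V \<Longrightarrow> g \<in> V \<Longrightarrow> N (\<lambda>x. f x - g x) = N (\<lambda>x. g x - f x)"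
  using norm_minus[of "\<lambda>x. f x - g x"] diff_mem by simp

lemma norm_triangle_diff:
  "f \<in> V \<Longrightarrow> g \<in> V \<Longrightarrow> h \<in> V \<Longrightarrow> N (\<lambda>x. f x - h x) \<le> N (\<lambda>x. f x - g x) + N (\<lambda>x. g x - h x)"
  using norm_triangle[of "\<lambda>x. f x - g x" "\<lambda>x. g x - h x"] diff_mem by simp

lemma norm_le_add_diff: "f \<in> V \<Longrightarrow> g \<in> V \<Longrightarrow> N f \<le> N g + N (\<lambda>x. f x - g x)"
  using norm_triangle[of g "\<lambda>x. f x - g x"] diff_mem by simp

lemma complete:
  assumes s: "\<And>n. s n \<in> V"
    and cauchy: "\<And>e. 0 < e \<Longrightarrow> \<exists>n0. \<forall>m\<ge>n0. \<forall>n\<ge>n0. N (\<lambda>x. s m x - s n x) < e"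
  shows "\<exists>f\<in>V. (\<lambda>n. N (\<lambda>x. s n x - f x)) \<longlonglongrightarrow> 0"
proof -
  have "range s \<subseteq> V \<and> (\<forall>e>0. \<exists>n0. \<forall>m\<ge>n0. \<forall>n\<ge>n0. ndist N (s m) (s n) < e)"
    using s cauchy unfolding ndist_def by auto
  then have "\<exists>f\<in>V. (\<lambda>n. ndist N (s n) f) \<longlonglongrightarrow> 0"
    using banach unfolding banach_function_space_def complete_norm_on_def by simp
  then show ?thesis
    unfolding ndist_def .
qed

lemma norm_geometric_tail:
  assumes s: "\<And>n. s n \<in> V" and r: "0 < r" "r < 1"
    and step: "\<And>n. N (\<lambda>x. s (Suc n) x - s n x) \<le> r ^ n"
  shows "N (\<lambda>x. s (n + k) x - s n x) \<le> r ^ n / (1 - r)"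
proof -
  have "N (\<lambda>x. s (n + k) x - s n x) \<le> r ^ n / (1 - r) - r ^ (n + k) / (1 - r)"
  proof (induction k)
    case (Suc k)
    have "N (\<lambda>x. s (n + Suc k) x - s n x)
        \<le> N (\<lambda>x. s (Suc (n + k)) x - s (n + k) x) + N (\<lambda>x. s (n + k) x - s n x)"
      using norm_triangle_diff[OF s s s] by simp
    also have "\<dots> \<le> r ^ (n + k) + (r ^ n / (1 - r) - r ^ (n + k) / (1 - r))"
      using step Suc by (intro add_mono)
    also have "r ^ (n + k) + (r ^ n / (1 - r) - r ^ (n + k) / (1 - r)) =
        r ^ n / (1 - r) - r ^ (n + Suc k) / (1 - r)"
    proof -
      have "r ^ (n + k) = r ^ (n + k) * (1 - r) / (1 - r)"
        using r by simp
      also have "r ^ (n + k) * (1 - r) = r ^ (n + k) - r ^ (n + Suc k)"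
        by (simp add: algebra_simps)
      finally have "r ^ (n + k) = r ^ (n + k) / (1 - r) - r ^ (n + Suc k) / (1 - r)"
        by (simp only: diff_divide_distrib)
      then show ?thesis
        by linarith
    qed
    finally show ?case .
  qed simp
  also have "\<dots> \<le> r ^ n / (1 - r)"
    using r by simp
  finally show ?thesis .
qed

text \<open>
  Completeness in the only form used below: geometrically small increments give a limit together
  with an explicit error bound.
\<close>

lemma geometric_limit:
  assumes s: "\<And>n. s n \<in> V" and r: "0 < r" "r < 1"
    and step: "\<And>n. N (\<lambda>x. s (Suc n) x - s n x) \<le> r ^ n"
  obtains f where "f \<in> V" "\<And>n. N (\<lambda>x. f x - s n x) \<le> r ^ n / (1 - r)"
proof -
  note tail = norm_geometric_tail[OF s r step]
  have null: "(\<lambda>n. r ^ n / (1 - r)) \<longlonglongrightarrow> 0"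
    using r by (intro tendsto_divide_zero LIMSEQ_power_zero) simp
  have cauchy: "\<exists>n0. \<forall>m\<ge>n0. \<forall>n\<ge>n0. N (\<lambda>x. s m x - s n x) < e" if "0 < e" for e
  proof -
    have "eventually (\<lambda>n. r ^ n / (1 - r) < e / 2) sequentially"
      using order_tendstoD(2)[OF null, of "e / 2"] \<open>0 < e\<close> by simp
    then obtain n0 where n0: "r ^ n0 / (1 - r) < e / 2"
      unfolding eventually_sequentially by blast
    have "N (\<lambda>x. s m x - s n x) < e" if "n0 \<le> m" "n0 \<le> n" for m n
    proof -
      have "N (\<lambda>x. s m x - s n0 x) \<le> r ^ n0 / (1 - r)" "N (\<lambda>x. s n x - s n0 x) \<le> r ^ n0 / (1 - r)"
        using tail[of n0 "m - n0"] tail[of n0 "n - n0"] that by simp_all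
      then show ?thesis
        using norm_triangle_diff[OF s[of m] s[of n0] s[of n]] norm_diff_commute[OF s[of n0] s[of n]] n0
        by linarith
    qed
    then show ?thesis
      by blast
  qed
  obtain f where f: "f \<in> V" "(\<lambda>n. N (\<lambda>x. s n x - f x)) \<longlonglongrightarrow> 0"
    using complete[OF s cauchy] by blast
  have "N (\<lambda>x. f x - s n x) \<le> r ^ n / (1 - r)" for n
  proof -
    have "N (\<lambda>x. f x - s n x) \<le> N (\<lambda>x. s (n + k) x - f x) + r ^ n / (1 - r)" for k
      using norm_triangle_diff[OF f(1) s[of "n + k"] s[of n]] tail[of n k]
        norm_diff_commute[OF f(1) s[of "n + k"]] by linarith
    moreover have "(\<lambda>k. N (\<lambda>x. s (n + k) x - f x) + r ^ n / (1 - r)) \<longlonglongrightarrow> 0 + r ^ n / (1 - r)"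
      using LIMSEQ_ignore_initial_segment[OF f(2), of n]
      by (intro tendsto_add tendsto_const) (simp add: add.commute)
    ultimately show ?thesis
      using LIMSEQ_le_const[of _ "0 + r ^ n / (1 - r)" "N (\<lambda>x. f x - s n x)"] by simp
  qed
  with f(1) that show ?thesis
    by blast
qed

text \<open>
  Continuity is given by \<open>\<epsilon>\<close>-\<open>\<delta>\<close> conditions; by rescaling, the condition at zero already yields a
  bound linear in the norm. The rescaling is by positive factors only, so that \<open>q\<close> may be the total
  variation norm as well as the modulus of a linear functional.
\<close>

lemma bounded_if_continuous_at_zero:
  assumes scale: "\<And>c f. 0 < c \<Longrightarrow> f \<in> V \<Longrightarrow> q (\<lambda>x. c * f x) = c * q f"
    and cont: "\<exists>d>0. \<forall>f\<in>V. N f < d \<longrightarrow> q f < (1::real)"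
  obtains C where "0 < C" "\<And>f. f \<in> V \<Longrightarrow> q f \<le> C * N f"
proof -
  obtain d where d: "0 < d" "\<And>f. f \<in> V \<Longrightarrow> N f < d \<Longrightarrow> q f < 1"
    using cont by blast
  have "q f \<le> 2 / d * N f" if f: "f \<in> V" for f
  proof (cases "N f = 0")
    case True
    then have "f = (\<lambda>x. 0)"
      using norm_eq_zero f by blast
    moreover have "q (\<lambda>x. 0) = 0"
      using scale[of 2 "\<lambda>x. 0"] by simp
    ultimately show ?thesis
      by simp
  next
    case False
    then have pos: "0 < N f"
      using norm_nonneg[OF f] by simp
    define c where "c = d / (2 * N f)"
    have c: "0 < c"
      unfolding c_def using pos d(1) by simp
    have "N (\<lambda>x. c * f x) = d / 2"
      using norm_scale[OF f, of c] pos d(1) unfolding c_def by (simp add: abs_of_pos)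
    then have "c * q f < 1"
      using d(2)[of "\<lambda>x. c * f x"] d(1) scale_mem[OF f] scale[OF c f] by simp
    then have "q f < 1 / c"
      using c by (simp add: field_simps)
    then show ?thesis
      unfolding c_def by simp
  qed
  then show ?thesis
    using that[of "2 / d"] d(1) by auto
qed

lemma continuous_if_bounded:
  assumes q: "\<And>f. f \<in> V \<Longrightarrow> q f \<le> C * N f" and f: "f \<in> V" and e: "0 < e"
  shows "\<exists>d>0. \<forall>g\<in>V. ndist N g f < d \<longrightarrow> q (\<lambda>x. g x - f x) < e"
proof -
  have "q (\<lambda>x. g x - f x) < e" if g: "g \<in> V" "ndist N g f < e / (\<bar>C\<bar> + 1)" for g
  proof -
    have d: "(\<lambda>x. g x - f x) \<in> V"
      using g f by blast
    have "q (\<lambda>x. g x - f x) \<le> C * ndist N g f"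
      using q[OF d] unfolding ndist_def .
    also have "\<dots> \<le> (\<bar>C\<bar> + 1) * ndist N g f"
      using norm_nonneg[OF d] unfolding ndist_def by (intro mult_right_mono) auto
    also have "\<dots> < e"
      using g(2) by (simp add: field_simps add_pos_nonneg)
    finally show ?thesis .
  qed
  then show ?thesis
    using e by (intro exI[of _ "e / (\<bar>C\<bar> + 1)"]) auto
qed

text \<open>
  Banach--Steinhaus for a pointwise bounded family of bounded seminorms, by Sokal's gliding hump.
  If the operator norms are unbounded, choose seminorms of norm \<open>K\<^sub>n \<ge> 4\<^sup>n\<close> and almost norming unit
  vectors \<open>v\<^sub>n\<close>, and add up \<open>\<plusminus> 3\<^sup>-\<^sup>n v\<^sub>n\<close>. For a suitable choice of each sign the \<open>n\<close>-th partial sum has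
  seminorm at least \<open>2/3 K\<^sub>n 3\<^sup>-\<^sup>n\<close>, while all later terms together change it by at most
  \<open>1/2 K\<^sub>n 3\<^sup>-\<^sup>n\<close>. Hence the limit has \<open>n\<close>-th seminorm at least \<open>(4/3)\<^sup>n / 6\<close>.

  Working with seminorms rather than functionals covers the seminorms \<open>\<integral> \<bar>h\<bar> d\<nu>\<close> over sets and the
  moduli of functionals alike.
\<close>

theorem uniform_boundedness:
  fixes p :: "'j \<Rightarrow> ('i \<Rightarrow> real) \<Rightarrow> real"
  assumes add: "\<And>i f g. i \<in> J \<Longrightarrow> f \<in> V \<Longrightarrow> g \<in> V \<Longrightarrow> p i (\<lambda>x. f x + g x) \<le> p i f + p i g"
    and scale: "\<And>i c f. i \<in> J \<Longrightarrow> f \<in> V \<Longrightarrow> p i (\<lambda>x. c * f x) = \<bar>c\<bar> * p i f"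
    and bounded: "\<And>i. i \<in> J \<Longrightarrow> \<exists>C. \<forall>f\<in>V. p i f \<le> C * N f"
    and pointwise: "\<And>f. f \<in> V \<Longrightarrow> \<exists>B. \<forall>i\<in>J. p i f \<le> B"
  obtains C where "\<And>i f. i \<in> J \<Longrightarrow> f \<in> V \<Longrightarrow> p i f \<le> C * N f"
proof -
  have "\<exists>C. \<forall>i\<in>J. \<forall>f\<in>V. p i f \<le> C * N f"
  proof (rule ccontr)
    assume "\<not> (\<exists>C. \<forall>i\<in>J. \<forall>f\<in>V. p i f \<le> C * N f)"
    then have unbounded: "\<exists>i\<in>J. \<exists>f\<in>V. C * N f < p i f" for C
      by (meson not_le)
    have choose: "\<exists>i K v. i \<in> J \<and> 4 ^ n \<le> K \<and> (\<forall>f\<in>V. p i f \<le> K * N f) \<and>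
        v \<in> V \<and> N v \<le> 1 \<and> 2 / 3 * K \<le> p i v" for n :: nat
    proof -
      obtain i f where i: "i \<in> J" and f: "f \<in> V" and large: "4 ^ n * N f < p i f"
        using unbounded by blast
      obtain C where C: "\<And>f. f \<in> V \<Longrightarrow> p i f \<le> C * N f"
        using bounded[OF i] by blast
      have pos: "0 < N f"
        using C[OF f] large norm_nonneg[OF f] by (cases "N f = 0") auto
      define S where "S = {p i v |v. v \<in> V \<and> N v \<le> 1}"
      have bdd: "bdd_above S"
        unfolding S_def
      proof (rule bdd_aboveI)
        fix a assume "a \<in> {p i v |v. v \<in> V \<and> N v \<le> 1}"
        then obtain v where v: "v \<in> V" "N v \<le> 1" "a = p i v" by blast
        have "C * N v \<le> \<bar>C\<bar> * 1"
          using v norm_nonneg[OF v(1)] by (intro mult_mono) auto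
        then show "a \<le> \<bar>C\<bar>"
          using C[OF v(1)] v by linarith
      qed
      define u where "u = (\<lambda>x. 1 / N f * f x)"
      have u: "u \<in> V" "N u = 1" "p i u = p i f / N f"
        unfolding u_def
        using scale_mem[OF f, of "1 / N f"] pos norm_scale[OF f, of "1 / N f"]
          scale[OF i f, of "1 / N f"] by auto
      have "p i u \<in> S"
        unfolding S_def using u(1,2) by (intro CollectI exI[of _ u]) simp
      then have "p i f / N f \<le> Sup S"
        using cSup_upper[OF _ bdd, of "p i u"] u(3) by simp
      then have "p i f \<le> Sup S * N f"
        using pos by (simp add: pos_divide_le_eq)
      with large have "4 ^ n * N f < Sup S * N f"
        by linarith
      then have K: "4 ^ n < Sup S"
        using pos mult_less_cancel_right_pos by blast
      then have "2 / 3 * Sup S < Sup S"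
        using zero_less_power[of "4::real" n] by linarith
      then obtain v where v: "v \<in> V" "N v \<le> 1" "2 / 3 * Sup S < p i v"
        using less_cSup_iff[of S "2 / 3 * Sup S"] bdd \<open>p i u \<in> S\<close> unfolding S_def by auto
      have "p i g \<le> Sup S * N g" if g: "g \<in> V" for g
      proof (cases "N g = 0")
        case True
        then show ?thesis
          using C[OF g] by simp
      next
        case False
        then have pos: "0 < N g"
          using norm_nonneg[OF g] by simp
        have "N (\<lambda>x. 1 / N g * g x) = 1"
          using norm_scale[OF g, of "1 / N g"] pos by simp
        then have "p i (\<lambda>x. 1 / N g * g x) \<in> S"
          unfolding S_def using scale_mem[OF g, of "1 / N g"]
          by (intro CollectI exI[of _ "\<lambda>x. 1 / N g * g x"]) simp
        then have "p i (\<lambda>x. 1 / N g * g x) \<le> Sup S"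
          using bdd by (rule cSup_upper)
        then have "p i g / N g \<le> Sup S"
          using scale[OF i g, of "1 / N g"] pos by simp
        then show ?thesis
          using pos by (simp add: field_simps)
      qed
      then show ?thesis
        using i K v by (meson less_imp_le)
    qed
    obtain i K v where iKv: "\<And>n::nat. i n \<in> J" "\<And>n. 4 ^ n \<le> K n"
        "\<And>n f. f \<in> V \<Longrightarrow> p (i n) f \<le> K n * N f"
        "\<And>n. v n \<in> V" "\<And>n. N (v n) \<le> 1" "\<And>n. 2 / 3 * K n \<le> p (i n) (v n)"
      using choose by metis
    have subadd: "p (i n) (\<lambda>x. f x + g x) \<le> p (i n) f + p (i n) g" if "f \<in> V" "g \<in> V" for n f g
      using add[OF iKv(1)] that .
    have even: "p (i n) (\<lambda>x. - f x) = p (i n) f" if "f \<in> V" for n f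
      using scale[OF iKv(1) that, where c = "-1"] by simp
    define u where "u n = (\<lambda>x. (1 / 3) ^ n * v n x)" for n
    have u: "u n \<in> V" "N (u n) \<le> (1 / 3) ^ n" "2 / 3 * K n * (1 / 3) ^ n \<le> p (i n) (u n)" for n
    proof -
      show "u n \<in> V"
        unfolding u_def using iKv(4) by blast
      show "N (u n) \<le> (1 / 3) ^ n"
        unfolding u_def using norm_scale[OF iKv(4), of "(1 / 3) ^ n"] iKv(5)
        by (simp add: mult_left_le)
      show "2 / 3 * K n * (1 / 3) ^ n \<le> p (i n) (u n)"
        unfolding u_def scale[OF iKv(1) iKv(4)]
        using mult_right_mono[OF iKv(6)[of n], of "(1 / 3) ^ n"] by (simp add: ac_simps)
    qed
    \<comment> \<open>If both signs failed, then \<open>2 u = (f + u) - (f - u)\<close> would violate the triangle inequality.\<close>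
    have choose_sign: "p (i n) (u n) \<le> p (i n) (\<lambda>x. f x - u n x)"
      if "f \<in> V" "\<not> p (i n) (u n) \<le> p (i n) (\<lambda>x. f x + u n x)" for n f
    proof -
      have "2 * p (i n) (u n) = p (i n) (\<lambda>x. 2 * u n x)"
        using scale[OF iKv(1) u(1), where c = 2] by simp
      also have "(\<lambda>x. 2 * u n x) = (\<lambda>x. (f x + u n x) + - (f x - u n x))"
        by auto
      also have "p (i n) \<dots> \<le> p (i n) (\<lambda>x. f x + u n x) + p (i n) (\<lambda>x. - (f x - u n x))"
        using that u(1) by (intro subadd minus_mem diff_mem add_mem)
      also have "p (i n) (\<lambda>x. - (f x - u n x)) = p (i n) (\<lambda>x. f x - u n x)"
        using that u(1) by (intro even diff_mem)
      finally show ?thesis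
        using that by linarith
    qed
    define w where "w = rec_nat (\<lambda>x. 0) (\<lambda>n f.
        if p (i n) (u n) \<le> p (i n) (\<lambda>x. f x + u n x) then (\<lambda>x. f x + u n x) else (\<lambda>x. f x - u n x))"
    have w_Suc: "w (Suc n) = (if p (i n) (u n) \<le> p (i n) (\<lambda>x. w n x + u n x)
        then (\<lambda>x. w n x + u n x) else (\<lambda>x. w n x - u n x))" for n
      unfolding w_def by simp
    have w: "w n \<in> V" for n
    proof (induction n)
      case 0
      then show ?case by (simp add: w_def)
    next
      case (Suc n)
      then show ?case
        unfolding w_Suc using u(1) by auto
    qed
    have large: "p (i n) (u n) \<le> p (i n) (w (Suc n))" for n
      unfolding w_Suc using choose_sign[OF w] by auto
    have step: "N (\<lambda>x. w (Suc n) x - w n x) \<le> (1 / 3) ^ n" for n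
      unfolding w_Suc using u(1,2)[of n] norm_minus[OF u(1)[of n]] by auto
    obtain g where g: "g \<in> V" "\<And>n. N (\<lambda>x. g x - w n x) \<le> (1 / 3) ^ n / (1 - 1 / 3)"
      using geometric_limit[of w "1 / 3"] w step by auto
    have lower: "(4 / 3) ^ n / 6 \<le> p (i n) g" for n
    proof -
      have K: "0 \<le> K n"
        using iKv(2)[of n] zero_less_power[of "4::real" n] by linarith
      have dV: "(\<lambda>x. g x - w (Suc n) x) \<in> V"
        using g(1) w by blast
      have "p (i n) (w (Suc n)) = p (i n) (\<lambda>x. g x + - (g x - w (Suc n) x))"
        by simp
      also have "\<dots> \<le> p (i n) g + p (i n) (\<lambda>x. g x - w (Suc n) x)"
        using subadd[OF g(1) minus_mem[OF dV], of n] even[OF dV, of n] by linarith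
      also have "p (i n) (\<lambda>x. g x - w (Suc n) x) \<le> K n * ((1 / 3) ^ n / 2)"
        using iKv(3)[OF dV, of n] mult_left_mono[OF g(2)[of "Suc n"] K] by simp
      finally have "2 / 3 * K n * (1 / 3) ^ n - K n * ((1 / 3) ^ n / 2) \<le> p (i n) g"
        using large[of n] u(3)[of n] by linarith
      then have "K n * (1 / 3) ^ n / 6 \<le> p (i n) g"
        by (simp add: field_simps)
      moreover have "4 ^ n * (1 / 3) ^ n \<le> K n * (1 / 3) ^ n"
        using iKv(2)[of n] by (intro mult_right_mono) auto
      moreover have "(4 / 3) ^ n = 4 ^ n * (1 / 3 :: real) ^ n"
        by (simp add: power_divide)
      ultimately show ?thesis
        by linarith
    qed
    obtain B where B: "\<And>j. j \<in> J \<Longrightarrow> p j g \<le> B"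
      using pointwise[OF g(1)] by blast
    then have growth: "(4 / 3) ^ n \<le> 6 * B" for n
      using lower[of n] B[OF iKv(1)[of n]] by linarith
    obtain n where "6 * B < (4 / 3) ^ n"
      using real_arch_pow[of "4 / 3" "6 * B"] by auto
    with growth[of n] show False
      by simp
  qed
  then show ?thesis
    using that by blast
qed

end

section \<open>Images of Banach spaces under pointwise bounded operators\<close>

text \<open>
  A linear map from a Banach space into functions on \<open>X\<close> all of whose evaluations are bounded. Its
  image, identified with the quotient by the (closed) kernel, is a proper Banach space of functions.
  Both the integral reproducing kernel Banach space and the sum of two reproducing kernel Hilbert
  spaces arise in this way.
\<close>

locale pointwise_bounded_operator = banach_functions I V N
  for I :: "'i set" and V N +
  fixes X :: "'a set" and T :: "('i \<Rightarrow> real) \<Rightarrow> 'a \<Rightarrow> real"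
  assumes nonempty: "X \<noteq> {}"
    and T_outside: "v \<in> V \<Longrightarrow> x \<notin> X \<Longrightarrow> T v x = 0"
    and T_add: "u \<in> V \<Longrightarrow> v \<in> V \<Longrightarrow> T (\<lambda>i. u i + v i) = (\<lambda>x. T u x + T v x)"
    and T_scale: "v \<in> V \<Longrightarrow> T (\<lambda>i. c * v i) = (\<lambda>x. c * T v x)"
    and T_bounded: "x \<in> X \<Longrightarrow> \<exists>C. \<forall>v\<in>V. \<bar>T v x\<bar> \<le> C * N v"
begin

definition quotient_norm :: "('a \<Rightarrow> real) \<Rightarrow> real" where
  "quotient_norm f = Inf {N v |v. v \<in> V \<and> T v = f}"

lemma T_zero: "T (\<lambda>i. 0) = (\<lambda>x. 0)"
  using T_scale[OF zero_mem, of 0] by simp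

lemma T_diff:
  assumes "u \<in> V" "v \<in> V"
  shows "T (\<lambda>i. u i - v i) = (\<lambda>x. T u x - T v x)"
  using T_add[OF assms(1) scale_mem[OF assms(2)], of "-1"] T_scale[OF assms(2), of "-1"] by simp

lemma T_bounded_pos:
  assumes "x \<in> X"
  obtains C where "0 < C" "\<And>v. v \<in> V \<Longrightarrow> \<bar>T v x\<bar> \<le> C * N v"
proof -
  obtain C where C: "\<And>v. v \<in> V \<Longrightarrow> \<bar>T v x\<bar> \<le> C * N v"
    using T_bounded[OF assms] by blast
  have "\<bar>T v x\<bar> \<le> (\<bar>C\<bar> + 1) * N v" if "v \<in> V" for v
  proof -
    have "C * N v \<le> (\<bar>C\<bar> + 1) * N v"
      using norm_nonneg[OF that] by (intro mult_right_mono) auto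
    with C[OF that] show ?thesis
      by linarith
  qed
  then show ?thesis
    using that[of "\<bar>C\<bar> + 1"] by simp
qed

lemma quotient_norm_le: "v \<in> V \<Longrightarrow> quotient_norm (T v) \<le> N v"
  unfolding quotient_norm_def
  by (intro cInf_lower bdd_belowI[where m = 0]) (auto simp: norm_nonneg)

lemma quotient_norm_greatest:
  assumes "v \<in> V" and "\<And>u. u \<in> V \<Longrightarrow> T u = T v \<Longrightarrow> b \<le> N u"
  shows "b \<le> quotient_norm (T v)"
  unfolding quotient_norm_def using assms by (intro cInf_greatest) auto

lemma quotient_norm_less:
  assumes f: "f \<in> T ` V" and less: "quotient_norm f < b"
  obtains u where "u \<in> V" "T u = f" "N u < b"
proof -
  obtain v where v: "v \<in> V" "f = T v"
    using f by blast
  have "\<not> (\<forall>u\<in>V. T u = T v \<longrightarrow> b \<le> N u)"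
    using quotient_norm_greatest[OF v(1), of b] less v(2) by auto
  then show ?thesis
    using that v(2) by (auto simp: not_le)
qed

lemma quotient_norm_nonneg: "f \<in> T ` V \<Longrightarrow> 0 \<le> quotient_norm f"
  using quotient_norm_greatest norm_nonneg by blast

text \<open>
  The bound on evaluation passes to the infimum over all representatives. This makes the quotient
  norm definite, and the image a proper Banach space of functions.
\<close>

lemma quotient_norm_eval:
  assumes "x \<in> X"
  obtains C where "0 < C" "\<And>f. f \<in> T ` V \<Longrightarrow> \<bar>f x\<bar> \<le> C * quotient_norm f"
proof -
  obtain C where C: "0 < C" "\<And>v. v \<in> V \<Longrightarrow> \<bar>T v x\<bar> \<le> C * N v"
    using T_bounded_pos[OF assms] by blast
  have "\<bar>T v x\<bar> \<le> C * quotient_norm (T v)" if v: "v \<in> V" for v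
  proof -
    have "\<bar>T v x\<bar> / C \<le> quotient_norm (T v)"
    proof (rule quotient_norm_greatest[OF v])
      fix u assume u: "u \<in> V" "T u = T v"
      then show "\<bar>T v x\<bar> / C \<le> N u"
        using C(2)[OF u(1)] C(1) by (simp add: field_simps)
    qed
    then show ?thesis
      using C(1) by (simp add: field_simps)
  qed
  then show ?thesis
    using that[of C] C(1) by blast
qed

lemma function_space_image: "function_space X (T ` V)"
  unfolding function_space_def
proof (intro conjI ballI allI)
  show "T ` V \<subseteq> functions_on X"
    unfolding functions_on_def using T_outside by auto
  show "(\<lambda>x. 0) \<in> T ` V"
    using T_zero zero_mem by (metis image_eqI)
  show "(\<lambda>x. f x + g x) \<in> T ` V" if "f \<in> T ` V" "g \<in> T ` V" for f g
    using that by (auto simp: T_add[symmetric])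
  show "(\<lambda>x. c * f x) \<in> T ` V" if "f \<in> T ` V" for c f
    using that by (auto simp: T_scale[symmetric])
qed

lemma quotient_norm_triangle:
  assumes "f \<in> T ` V" "g \<in> T ` V"
  shows "quotient_norm (\<lambda>x. f x + g x) \<le> quotient_norm f + quotient_norm g"
proof (rule field_le_epsilon)
  fix e :: real assume e: "0 < e"
  obtain u where u: "u \<in> V" "T u = f" "N u < quotient_norm f + e / 2"
    using quotient_norm_less[OF assms(1), of "quotient_norm f + e / 2"] e by auto
  obtain v where v: "v \<in> V" "T v = g" "N v < quotient_norm g + e / 2"
    using quotient_norm_less[OF assms(2), of "quotient_norm g + e / 2"] e by auto
  have "quotient_norm (T (\<lambda>i. u i + v i)) \<le> N (\<lambda>i. u i + v i)"
    using u v by (intro quotient_norm_le add_mem)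
  then show "quotient_norm (\<lambda>x. f x + g x) \<le> quotient_norm f + quotient_norm g + e"
    using T_add[OF u(1) v(1)] norm_triangle[OF u(1) v(1)] u v by simp
qed

lemma quotient_norm_scale_le:
  assumes f: "f \<in> T ` V"
  shows "quotient_norm (\<lambda>x. c * f x) \<le> \<bar>c\<bar> * quotient_norm f"
proof (cases "c = 0")
  case True
  then show ?thesis
    using quotient_norm_le[OF zero_mem] T_zero by simp
next
  case False
  obtain v where v: "v \<in> V" "f = T v"
    using f by blast
  have "quotient_norm (\<lambda>x. c * f x) / \<bar>c\<bar> \<le> quotient_norm (T v)"
  proof (rule quotient_norm_greatest[OF v(1)])
    fix u assume u: "u \<in> V" "T u = T v"
    then show "quotient_norm (\<lambda>x. c * f x) / \<bar>c\<bar> \<le> N u"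
      using quotient_norm_le[OF scale_mem[OF u(1)], of c] T_scale[OF u(1), of c]
        norm_scale[OF u(1), of c] False v by (simp add: field_simps)
  qed
  then show ?thesis
    using False v by (simp add: field_simps)
qed

lemma quotient_norm_scale:
  assumes f: "f \<in> T ` V"
  shows "quotient_norm (\<lambda>x. c * f x) = \<bar>c\<bar> * quotient_norm f"
proof (cases "c = 0")
  case True
  then show ?thesis
    using quotient_norm_scale_le[OF f, of 0] quotient_norm_nonneg[of "\<lambda>x. 0"]
      function_space_image unfolding function_space_def by auto
next
  case False
  have "(\<lambda>x. c * f x) \<in> T ` V"
    using f function_space_image unfolding function_space_def by blast
  then have "quotient_norm (\<lambda>x. 1 / c * (c * f x)) \<le> \<bar>1 / c\<bar> * quotient_norm (\<lambda>x. c * f x)"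
    by (rule quotient_norm_scale_le)
  then have "\<bar>c\<bar> * quotient_norm f \<le> quotient_norm (\<lambda>x. c * f x)"
    using False by (simp add: field_simps)
  then show ?thesis
    using quotient_norm_scale_le[OF f, of c] by simp
qed

lemma is_norm_quotient_norm: "is_norm_on (T ` V) quotient_norm"
  unfolding is_norm_on_def
proof (intro conjI ballI allI iffI)
  fix f assume f: "f \<in> T ` V"
  show "f = (\<lambda>x. 0)" if "quotient_norm f = 0"
  proof
    fix x
    show "f x = 0"
    proof (cases "x \<in> X")
      case True
      then show ?thesis
        using quotient_norm_eval[of x] f that by (metis abs_le_zero_iff mult_zero_right)
    qed (use f T_outside in auto)
  qed
  show "quotient_norm f = 0" if "f = (\<lambda>x. 0)"
    using quotient_norm_scale[OF f, of 0] that by simp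
qed (simp_all add: quotient_norm_nonneg quotient_norm_scale quotient_norm_triangle)

text \<open>
  A subsequence with geometrically small steps has representatives that converge: lift the steps, not
  the terms, to vectors of almost the same norm, and add them up.
\<close>

lemma complete_quotient_norm: "complete_norm_on (T ` V) quotient_norm"
  unfolding complete_norm_on_def
proof (intro allI impI, elim conjE)
  fix s :: "nat \<Rightarrow> 'a \<Rightarrow> real"
  assume "range s \<subseteq> T ` V"
    and cauchy: "\<forall>e>0. \<exists>n0. \<forall>m\<ge>n0. \<forall>n\<ge>n0. ndist quotient_norm (s m) (s n) < e"
  then have s: "s n \<in> T ` V" for n
    by blast
  have diff_in: "(\<lambda>x. f x - g x) \<in> T ` V" if "f \<in> T ` V" "g \<in> T ` V" for f g
    using that by (auto simp: T_diff[symmetric] intro!: imageI)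
  have "\<exists>M. \<forall>m\<ge>M. \<forall>n\<ge>M. quotient_norm (\<lambda>x. s m x - s n x) < (1 / 2) ^ k" for k :: nat
    using cauchy unfolding ndist_def by simp
  then obtain M where M: "\<And>k m n. M k \<le> m \<Longrightarrow> M k \<le> n \<Longrightarrow>
      quotient_norm (\<lambda>x. s m x - s n x) < (1 / 2) ^ k"
    by metis
  \<comment> \<open>Any indices beyond the thresholds would do; partial sums dominate both \<open>M k\<close> and, at \<open>Suc k\<close>, the preceding ones.\<close>
  define r where "r k = (\<Sum>j\<le>k. M j)" for k :: nat
  have r: "M k \<le> r k" "M k \<le> r (Suc k)" for k
    unfolding r_def by (auto intro!: member_le_sum trans_le_add1)
  have "\<exists>v. v \<in> V \<and> T v = (\<lambda>x. s (r (Suc k)) x - s (r k) x) \<and> N v < (1 / 2) ^ k" for k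
    using quotient_norm_less[OF diff_in[OF s s] M[OF r(2) r(1)]] by blast
  then obtain v where v: "\<And>k. v k \<in> V" "\<And>k. T (v k) = (\<lambda>x. s (r (Suc k)) x - s (r k) x)"
      "\<And>k. N (v k) < (1 / 2) ^ k"
    by metis
  obtain v0 where v0: "v0 \<in> V" "T v0 = s (r 0)"
    using s[of "r 0"] by auto
  define u where "u = rec_nat v0 (\<lambda>k w i. w i + v k i)"
  have u_Suc: "u (Suc k) = (\<lambda>i. u k i + v k i)" for k
    unfolding u_def by simp
  have u: "u k \<in> V \<and> T (u k) = s (r k)" for k
  proof (induction k)
    case 0
    then show ?case using v0 by (simp add: u_def)
  next
    case (Suc k)
    then show ?case
      unfolding u_Suc using v add_mem T_add by auto
  qed
  have "N (\<lambda>i. u (Suc k) i - u k i) \<le> (1 / 2) ^ k" for k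
    unfolding u_Suc using v(3)[of k] by simp
  then obtain g where g: "g \<in> V" "\<And>k. N (\<lambda>i. g i - u k i) \<le> (1 / 2) ^ k / (1 - 1 / 2)"
    using geometric_limit[of u "1 / 2"] u by auto
  have close: "quotient_norm (\<lambda>x. s n x - T g x) < 3 * (1 / 2) ^ k" if "r k \<le> n" for n k
  proof -
    have "quotient_norm (\<lambda>x. s (r k) x - T g x) = quotient_norm (T (\<lambda>i. u k i - g i))"
      using T_diff[of "u k" g] u g(1) by simp
    also have "\<dots> \<le> N (\<lambda>i. u k i - g i)"
      using u g(1) by (intro quotient_norm_le diff_mem) auto
    also have "\<dots> \<le> 2 * (1 / 2) ^ k"
      using g(2)[of k] norm_diff_commute[of "u k" g] u g(1) by simp
    finally have "quotient_norm (\<lambda>x. s (r k) x - T g x) \<le> 2 * (1 / 2) ^ k" .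
    moreover have "quotient_norm (\<lambda>x. s n x - s (r k) x) < (1 / 2) ^ k"
      using M that r(1)[of k] by simp
    moreover have "quotient_norm (\<lambda>x. s n x - T g x)
        \<le> quotient_norm (\<lambda>x. s n x - s (r k) x) + quotient_norm (\<lambda>x. s (r k) x - T g x)"
      using quotient_norm_triangle[OF diff_in[OF s[of n] s[of "r k"]] diff_in[OF s[of "r k"] imageI[OF g(1)]]]
      by simp
    ultimately show ?thesis
      by linarith
  qed
  have "(\<lambda>n. ndist quotient_norm (s n) (T g)) \<longlonglongrightarrow> 0"
  proof (rule LIMSEQ_I)
    fix e :: real assume "0 < e"
    then obtain k where k: "(1 / 2) ^ k < e / 3"
      using real_arch_pow_inv[of "e / 3" "1 / 2"] by auto
    have "norm (ndist quotient_norm (s n) (T g) - 0) < e" if "r k \<le> n" for n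
      using close[OF that] k quotient_norm_nonneg[OF diff_in[OF s imageI[OF g(1)]], of n]
      unfolding ndist_def by simp
    then show "\<exists>n0. \<forall>n\<ge>n0. norm (ndist quotient_norm (s n) (T g) - 0) < e"
      by blast
  qed
  then show "\<exists>f\<in>T ` V. (\<lambda>n. ndist quotient_norm (s n) f) \<longlonglongrightarrow> 0"
    using g(1) by blast
qed

lemma banach_functions_image: "banach_functions X (T ` V) quotient_norm"
  using function_space_image is_norm_quotient_norm complete_quotient_norm
  by unfold_locales (simp add: banach_function_space_def)

end

lemma proper_bsfI:
  assumes "X \<noteq> {}" and "banach_functions X E N"
    and eval: "\<And>x. x \<in> X \<Longrightarrow> \<exists>C. \<forall>f\<in>E. \<bar>f x\<bar> \<le> C * N f"
  shows "proper_bsf X E N"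
proof -
  interpret E: banach_functions X E N by fact
  have "\<exists>d>0. \<forall>g\<in>E. ndist N g f < d \<longrightarrow> \<bar>g x - f x\<bar> < e" if x: "x \<in> X" and "f \<in> E" "0 < e" for x f e
  proof -
    obtain C where "\<And>f. f \<in> E \<Longrightarrow> \<bar>f x\<bar> \<le> C * N f"
      using eval[OF x] by blast
    from E.continuous_if_bounded[of "\<lambda>f. \<bar>f x\<bar>" C, OF this] that(2,3) show ?thesis
      by simp
  qed
  then show ?thesis
    unfolding proper_bsf_def bsf_def using assms(1) E.banach by blast
qed

lemma proper_bsf_eval_bounded:
  assumes E: "proper_bsf X E N" and x: "x \<in> X"
  obtains C where "0 < C" "\<And>f. f \<in> E \<Longrightarrow> \<bar>f x\<bar> \<le> C * N f"
proof -
  interpret E: banach_functions X E N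
    using E unfolding proper_bsf_def bsf_def by unfold_locales simp
  have "\<exists>d>0. \<forall>f\<in>E. N f < d \<longrightarrow> \<bar>f x\<bar> < 1"
  proof -
    have "\<exists>d>0. \<forall>g\<in>E. ndist N g (\<lambda>x. 0) < d \<longrightarrow> \<bar>g x - 0\<bar> < 1"
      using E x E.zero_mem unfolding proper_bsf_def by (metis zero_less_one)
    then show ?thesis
      unfolding ndist_def by simp
  qed
  then show ?thesis
    using that by (elim E.bounded_if_continuous_at_zero[rotated]) (auto simp: abs_mult)
qed

lemma (in pointwise_bounded_operator) proper_bsf_image: "proper_bsf X (T ` V) quotient_norm"
  using nonempty banach_functions_image quotient_norm_eval by (intro proper_bsfI) metis+

section \<open>Hilbert spaces of functions\<close>

text \<open>
  A quadratic polynomial in \<open>t\<close> that vanishes at its minimum \<open>t = 0\<close> has no linear part.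
\<close>

lemma linear_part_eq_zero:
  fixes a b :: real
  assumes "0 \<le> b" and nonneg: "\<And>t. 0 \<le> 2 * t * a + t\<^sup>2 * b"
  shows "a = 0"
proof -
  define s where "s = 1 / (b + 1)"
  have s: "0 < s" "s * b \<le> 1"
    unfolding s_def using assms(1) by simp_all
  have "0 \<le> 2 * (- (s * a)) * a + (- (s * a))\<^sup>2 * b"
    by (rule nonneg)
  also have "\<dots> = s * a\<^sup>2 * (s * b - 2)"
    by (simp add: power2_eq_square algebra_simps)
  also have "\<dots> \<le> s * a\<^sup>2 * (- 1)"
    using s by (intro mult_left_mono) auto
  finally have "s * a\<^sup>2 \<le> 0"
    by simp
  then show ?thesis
    using s(1) by (simp add: mult_le_0_iff)
qed

locale hilbert_functions = banach_functions I V N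
  for I :: "'i set" and V N +
  fixes ip :: "('i \<Rightarrow> real) \<Rightarrow> ('i \<Rightarrow> real) \<Rightarrow> real"
  assumes ip_commute: "f \<in> V \<Longrightarrow> g \<in> V \<Longrightarrow> ip f g = ip g f"
    and ip_add_left: "f \<in> V \<Longrightarrow> g \<in> V \<Longrightarrow> h \<in> V \<Longrightarrow> ip (\<lambda>x. f x + g x) h = ip f h + ip g h"
    and ip_scale_left: "f \<in> V \<Longrightarrow> g \<in> V \<Longrightarrow> ip (\<lambda>x. c * f x) g = c * ip f g"
    and ip_self: "f \<in> V \<Longrightarrow> ip f f = (N f)\<^sup>2"
begin

lemma ip_add_right: "f \<in> V \<Longrightarrow> g \<in> V \<Longrightarrow> h \<in> V \<Longrightarrow> ip h (\<lambda>x. f x + g x) = ip h f + ip h g"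
  by (simp only: ip_commute[of h] add_mem ip_add_left)

lemma ip_scale_right: "f \<in> V \<Longrightarrow> g \<in> V \<Longrightarrow> ip g (\<lambda>x. c * f x) = c * ip g f"
  by (simp only: ip_commute[of g] scale_mem ip_scale_left)

lemma ip_diff_left: "f \<in> V \<Longrightarrow> g \<in> V \<Longrightarrow> h \<in> V \<Longrightarrow> ip (\<lambda>x. f x - g x) h = ip f h - ip g h"
  using ip_add_left[of f "\<lambda>x. -1 * g x" h] ip_scale_left[of g h "-1"] minus_mem[of g] by simp

lemma ip_diff_right: "f \<in> V \<Longrightarrow> g \<in> V \<Longrightarrow> h \<in> V \<Longrightarrow> ip h (\<lambda>x. f x - g x) = ip h f - ip h g"
  by (simp only: ip_commute[of h] diff_mem ip_diff_left)

lemma norm_add_square: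
  "f \<in> V \<Longrightarrow> g \<in> V \<Longrightarrow> (N (\<lambda>x. f x + g x))\<^sup>2 = (N f)\<^sup>2 + 2 * ip f g + (N g)\<^sup>2"
  using ip_self[of "\<lambda>x. f x + g x"] ip_commute[of g f] add_mem[of f g]
  by (simp add: ip_add_left[of f g] ip_add_right[of f g] ip_self)

lemma norm_diff_square:
  "f \<in> V \<Longrightarrow> g \<in> V \<Longrightarrow> (N (\<lambda>x. f x - g x))\<^sup>2 = (N f)\<^sup>2 - 2 * ip f g + (N g)\<^sup>2"
  using ip_self[of "\<lambda>x. f x - g x"] ip_commute[of g f] diff_mem[of f g]
  by (simp add: ip_diff_left[of f g] ip_diff_right[of f g] ip_self)

lemma cauchy_schwarz:
  assumes f: "f \<in> V" and g: "g \<in> V"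
  shows "\<bar>ip f g\<bar> \<le> N f * N g"
proof -
  have "(N (\<lambda>x. f x + g x))\<^sup>2 \<le> (N f + N g)\<^sup>2" "(N (\<lambda>x. f x - g x))\<^sup>2 \<le> (N f + N g)\<^sup>2"
    using norm_triangle[OF f g] norm_triangle[OF f minus_mem[OF g]] norm_minus[OF g]
      norm_nonneg[OF add_mem[OF f g]] norm_nonneg[OF diff_mem[OF f g]]
    by (simp_all add: power_mono)
  then show ?thesis
    unfolding norm_add_square[OF f g] norm_diff_square[OF f g] by (auto simp: power2_sum)
qed

lemma ip_tendsto:
  assumes w: "\<And>n. w n \<in> V" and g: "g \<in> V" and lim: "(\<lambda>n. N (\<lambda>x. w n x - g x)) \<longlonglongrightarrow> 0"
    and v: "v \<in> V"
  shows "(\<lambda>n. ip v (w n)) \<longlonglongrightarrow> ip v g"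
proof -
  have "(\<lambda>n. N v * N (\<lambda>x. w n x - g x)) \<longlonglongrightarrow> 0"
    using tendsto_mult_right_zero[OF lim] .
  moreover have "\<forall>n. norm (ip v (w n) - ip v g) \<le> N v * N (\<lambda>x. w n x - g x)"
    using cauchy_schwarz[OF v diff_mem[OF w g]] ip_diff_right[OF w g v] by simp
  ultimately have "(\<lambda>n. ip v (w n) - ip v g) \<longlonglongrightarrow> 0"
    by (rule Lim_null_comparison[OF always_eventually, rotated])
  then show ?thesis
    by (rule LIM_zero_cancel)
qed

text \<open>
  The Riesz representation theorem for a bounded linear functional \<open>\<phi>\<close> on a subspace \<open>W\<close> that need not
  be closed. A sequence in \<open>W\<close> that minimizes \<open>J u = \<parallel>u\<parallel>\<^sup>2 - 2 \<phi> u\<close> is Cauchy by the parallelogram law,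
  and the first variation of \<open>J\<close> at its limit \<open>g\<close> says that \<open>g\<close> represents \<open>\<phi>\<close>. That \<open>g\<close> is a limit of
  points of \<open>W\<close> is part of the conclusion: this replaces orthogonal projections (\<open>W\<close> closed, \<open>\<phi>\<close> the inner
  product with a vector) and density arguments (\<open>\<phi>\<close> represented by only one vector).
\<close>

theorem riesz_subspace:
  assumes W: "W \<subseteq> V" "(\<lambda>x. 0) \<in> W"
      "\<And>u v. u \<in> W \<Longrightarrow> v \<in> W \<Longrightarrow> (\<lambda>x. u x + v x) \<in> W" "\<And>c u. u \<in> W \<Longrightarrow> (\<lambda>x. c * u x) \<in> W"
    and \<phi>_add: "\<And>u v. u \<in> W \<Longrightarrow> v \<in> W \<Longrightarrow> \<phi> (\<lambda>x. u x + v x) = \<phi> u + \<phi> v"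
    and \<phi>_scale: "\<And>c u. u \<in> W \<Longrightarrow> \<phi> (\<lambda>x. c * u x) = c * \<phi> u"
    and \<phi>_bounded: "\<And>u. u \<in> W \<Longrightarrow> \<phi> u \<le> C * N u"
  obtains g w where "g \<in> V" "\<And>n::nat. w n \<in> W" "(\<lambda>n. N (\<lambda>x. w n x - g x)) \<longlonglongrightarrow> 0"
    "\<And>v. v \<in> W \<Longrightarrow> ip v g = \<phi> v"
proof -
  have WV: "u \<in> V" if "u \<in> W" for u
    using W(1) that by blast
  define J where "J u = (N u)\<^sup>2 - 2 * \<phi> u" for u
  define m where "m = Inf (J ` W)"
  have bdd: "bdd_below (J ` W)"
  proof (rule bdd_belowI2)
    fix u assume u: "u \<in> W"
    have "0 \<le> (N u)\<^sup>2 - 2 * (C * N u) + C\<^sup>2"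
      using zero_le_power2[of "N u - C"] by (simp add: power2_diff mult.commute mult.left_commute)
    then show "- C\<^sup>2 \<le> J u"
      unfolding J_def using \<phi>_bounded[OF u] by linarith
  qed
  have m_le: "m \<le> J u" if "u \<in> W" for u
    unfolding m_def using bdd that by (intro cINF_lower)
  have "\<exists>w\<in>W. J w < m + 1 / real (Suc n)" for n
  proof -
    have "Inf (J ` W) < m + 1 / real (Suc n)"
      unfolding m_def by simp
    moreover have "W \<noteq> {}"
      using W(2) by blast
    ultimately show ?thesis
      using cINF_less_iff[of W J] bdd by simp
  qed
  then obtain w where w: "\<And>n. w n \<in> W" "\<And>n. J (w n) < m + 1 / real (Suc n)"
    by metis
  have dist_square: "(N (\<lambda>x. u x - v x))\<^sup>2 \<le> 2 * (J u - m) + 2 * (J v - m)"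
    if u: "u \<in> W" and v: "v \<in> W" for u v
  proof -
    have uv: "(\<lambda>x. u x + v x) \<in> W"
      using W(3) u v .
    have "J (\<lambda>x. 1 / 2 * (u x + v x)) = (\<bar>1 / 2\<bar> * N (\<lambda>x. u x + v x))\<^sup>2 - 2 * (1 / 2 * (\<phi> u + \<phi> v))"
      unfolding J_def norm_scale[OF WV[OF uv]] \<phi>_scale[OF uv] \<phi>_add[OF u v] by (rule refl)
    also have "(\<bar>1 / 2\<bar> * N (\<lambda>x. u x + v x))\<^sup>2 = 1 / 4 * ((N u)\<^sup>2 + 2 * ip u v + (N v)\<^sup>2)"
      unfolding power_mult_distrib norm_add_square[OF WV[OF u] WV[OF v]] by (simp add: power_divide)
    finally have "4 * J (\<lambda>x. 1 / 2 * (u x + v x)) =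
        (N u)\<^sup>2 + 2 * ip u v + (N v)\<^sup>2 - 4 * \<phi> u - 4 * \<phi> v"
      by (simp add: field_simps)
    moreover have "4 * m \<le> 4 * J (\<lambda>x. 1 / 2 * (u x + v x))"
      by (intro mult_left_mono m_le W(4) uv) simp
    ultimately have "4 * m \<le> (N u)\<^sup>2 + 2 * ip u v + (N v)\<^sup>2 - 4 * \<phi> u - 4 * \<phi> v"
      by simp
    then show ?thesis
      unfolding norm_diff_square[OF WV[OF u] WV[OF v]] J_def[of u] J_def[of v]
      by (simp add: algebra_simps)
  qed
  have cauchy: "\<exists>n0. \<forall>i\<ge>n0. \<forall>j\<ge>n0. N (\<lambda>x. w i x - w j x) < e" if e: "0 < e" for e
  proof -
    obtain n0 :: nat where n0: "4 / e\<^sup>2 < real n0"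
      using reals_Archimedean2 by blast
    have "N (\<lambda>x. w i x - w j x) < e" if ij: "n0 \<le> i" "n0 \<le> j" for i j
    proof -
      have "1 / real (Suc l) < e\<^sup>2 / 4" if "n0 \<le> l" for l
      proof -
        have "4 / e\<^sup>2 < real (Suc l)"
          using n0 that by linarith
        then show ?thesis
          using e by (simp add: field_simps)
      qed
      from this[OF ij(1)] this[OF ij(2)]
      have "J (w i) - m < e\<^sup>2 / 4" "J (w j) - m < e\<^sup>2 / 4"
        using w(2)[of i] w(2)[of j] by linarith+
      then have "(N (\<lambda>x. w i x - w j x))\<^sup>2 < e\<^sup>2"
        using dist_square[OF w(1) w(1), of i j] by argo
      then show ?thesis
        using e by (intro power2_less_imp_less[of _ e]) simp_all
    qed
    then show ?thesis
      by blast
  qed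
  obtain g where g: "g \<in> V" "(\<lambda>n. N (\<lambda>x. w n x - g x)) \<longlonglongrightarrow> 0"
    using complete[OF WV[OF w(1)] cauchy] by blast
  have "ip v g = \<phi> v" if v: "v \<in> W" for v
  proof -
    have "0 \<le> 2 * t * (ip v g - \<phi> v) + t\<^sup>2 * (N v)\<^sup>2" for t
    proof -
      have lower: "- (1 / real (Suc n)) \<le> 2 * t * (ip v (w n) - \<phi> v) + t\<^sup>2 * (N v)\<^sup>2" for n
      proof -
        have "J (\<lambda>x. w n x + t * v x) = J (w n) + 2 * t * (ip v (w n) - \<phi> v) + t\<^sup>2 * (N v)\<^sup>2"
          unfolding J_def norm_add_square[OF WV[OF w(1)] scale_mem[OF WV[OF v]]]
            \<phi>_add[OF w(1) W(4)[OF v]] \<phi>_scale[OF v] norm_scale[OF WV[OF v]]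
            ip_scale_right[OF WV[OF v] WV[OF w(1)]] ip_commute[OF WV[OF w(1)] WV[OF v]]
          by (simp add: algebra_simps power_mult_distrib)
        moreover have "m \<le> J (\<lambda>x. w n x + t * v x)"
          by (intro m_le W(3) W(4) w(1) v)
        ultimately show ?thesis
          using w(2)[of n] by linarith
      qed
      have null: "(\<lambda>n. - (1 / real (Suc n))) \<longlonglongrightarrow> - 0"
        using LIMSEQ_inverse_real_of_nat by (intro tendsto_minus) (simp only: inverse_eq_divide)
      have "(\<lambda>n. ip v (w n)) \<longlonglongrightarrow> ip v g"
        using WV[OF w(1)] g WV[OF v] by (rule ip_tendsto)
      then have "(\<lambda>n. 2 * t * (ip v (w n) - \<phi> v) + t\<^sup>2 * (N v)\<^sup>2)
          \<longlonglongrightarrow> 2 * t * (ip v g - \<phi> v) + t\<^sup>2 * (N v)\<^sup>2"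
        by (intro tendsto_intros)
      from LIMSEQ_le[OF null this] lower
      have "- 0 \<le> 2 * t * (ip v g - \<phi> v) + t\<^sup>2 * (N v)\<^sup>2"
        by blast
      then show ?thesis
        by simp
    qed
    then have "ip v g - \<phi> v = 0"
      by (intro linear_part_eq_zero[of "(N v)\<^sup>2"]) auto
    then show ?thesis
      by simp
  qed
  then show ?thesis
    using that[OF g(1) w(1) g(2)] by blast
qed

corollary riesz:
  assumes "\<And>u v. u \<in> V \<Longrightarrow> v \<in> V \<Longrightarrow> \<phi> (\<lambda>x. u x + v x) = \<phi> u + \<phi> v"
    and "\<And>c u. u \<in> V \<Longrightarrow> \<phi> (\<lambda>x. c * u x) = c * \<phi> u"
    and "\<And>u. u \<in> V \<Longrightarrow> \<phi> u \<le> C * N u"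
  obtains g where "g \<in> V" "\<And>v. v \<in> V \<Longrightarrow> ip v g = \<phi> v"
proof (rule riesz_subspace[of V \<phi> C])
  fix g assume "g \<in> V" "\<And>v. v \<in> V \<Longrightarrow> ip v g = \<phi> v"
  then show thesis
    by (rule that)
qed (use assms in auto)

lemma hilbert_norm_on: "hilbert_norm_on V N"
  unfolding hilbert_norm_on_def
  by (intro exI[of _ ip]) (simp add: ip_commute[symmetric] ip_add_left ip_scale_left ip_self norm_nonneg
      ip_commute)

text \<open>
  The dual norm sees only the representing vector, at which the supremum is attained.
\<close>

lemma dual_norm_eq:
  assumes g: "g \<in> V" and \<phi>: "\<And>f. f \<in> V \<Longrightarrow> \<phi> f = ip f g"
  shows "dual_norm V N \<phi> = N g"
  unfolding dual_norm_def
proof (rule cSup_eq_maximum)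
  show "N g \<in> (\<lambda>f. \<bar>\<phi> f\<bar>) ` {f \<in> V. N f \<le> 1}"
  proof (cases "N g = 0")
    case True
    then have "\<bar>\<phi> (\<lambda>x. 0)\<bar> = N g"
      using \<phi>[OF zero_mem] cauchy_schwarz[OF zero_mem g] by simp
    then show ?thesis
      by (intro image_eqI[of _ _ "\<lambda>x. 0"]) auto
  next
    case False
    then have pos: "0 < N g"
      using norm_nonneg[OF g] by simp
    have "\<bar>\<phi> (\<lambda>x. 1 / N g * g x)\<bar> = N g"
      unfolding \<phi>[OF scale_mem[OF g]] ip_scale_left[OF g g] ip_self[OF g]
      using pos by (simp add: power2_eq_square)
    then show ?thesis
      using scale_mem[OF g, of "1 / N g"] norm_scale[OF g, of "1 / N g"] pos
      by (intro image_eqI[of _ _ "\<lambda>x. 1 / N g * g x"]) auto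
  qed
  show "a \<le> N g" if "a \<in> (\<lambda>f. \<bar>\<phi> f\<bar>) ` {f \<in> V. N f \<le> 1}" for a
  proof -
    obtain f where f: "f \<in> V" "N f \<le> 1" "a = \<bar>ip f g\<bar>"
      using \<open>a \<in> _\<close> \<phi> by auto
    have "N f * N g \<le> 1 * N g"
      using f norm_nonneg[OF g] by (intro mult_right_mono)
    then show ?thesis
      using cauchy_schwarz[OF f(1) g] f(3) by linarith
  qed
qed

text \<open>
  Polarization of the dual norm returns the inner product of the representing vectors.
\<close>

lemma dual_inner_eq:
  assumes g: "g \<in> V" and h: "h \<in> V"
    and \<phi>: "\<And>f. f \<in> V \<Longrightarrow> \<phi> f = ip f g" and \<psi>: "\<And>f. f \<in> V \<Longrightarrow> \<psi> f = ip f h"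
  shows "dual_inner V N \<phi> \<psi> = ip g h"
proof -
  have "dual_norm V N (\<lambda>f. \<phi> f + \<psi> f) = N (\<lambda>x. g x + h x)"
    using g h by (intro dual_norm_eq) (auto simp: \<phi> \<psi> ip_add_right)
  moreover have "dual_norm V N (\<lambda>f. \<phi> f - \<psi> f) = N (\<lambda>x. g x - h x)"
    using g h by (intro dual_norm_eq) (auto simp: \<phi> \<psi> ip_diff_right)
  ultimately show ?thesis
    unfolding dual_inner_def norm_add_square[OF g h, symmetric]
    by (simp add: norm_add_square[OF g h] norm_diff_square[OF g h])
qed

end

lemma hilbert_functions_if_hilbert_norm_on:
  assumes "banach_function_space I V N" "hilbert_norm_on V N"
  obtains ip where "hilbert_functions I V N ip"
proof -
  obtain ip where "\<forall>f\<in>V. \<forall>g\<in>V. ip f g = ip g f"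
      "\<forall>f\<in>V. \<forall>g\<in>V. \<forall>h\<in>V. ip (\<lambda>x. f x + g x) h = ip f h + ip g h"
      "\<forall>c. \<forall>f\<in>V. \<forall>g\<in>V. ip (\<lambda>x. c * f x) g = c * ip f g"
      "\<forall>f\<in>V. 0 \<le> ip f f \<and> N f = sqrt (ip f f)"
    using assms(2) unfolding hilbert_norm_on_def by blast
  with assms(1) have "hilbert_functions I V N ip"
    by unfold_locales auto
  then show ?thesis
    by (rule that)
qed

section \<open>Images of Hilbert spaces\<close>

locale hilbert_operator = hilbert_functions I V N ip + pointwise_bounded_operator I V N X T
  for I :: "'i set" and V N ip and X :: "'a set" and T
begin

text \<open>
  The kernel of \<open>T\<close> is closed because evaluations of \<open>T\<close> are bounded, so its component can be removed
  from \<open>v\<close>: it is the vector that represents \<open>ip \<cdot> v\<close> on the kernel.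
\<close>

lemma orthogonal_representative:
  assumes v: "v \<in> V"
  obtains u where "u \<in> V" "T u = T v" "\<And>w. w \<in> V \<Longrightarrow> T w = (\<lambda>x. 0) \<Longrightarrow> ip w u = 0"
proof -
  define W where "W = {w \<in> V. T w = (\<lambda>x. 0)}"
  obtain g w where g: "g \<in> V" and w: "\<And>n::nat. w n \<in> W"
    and lim: "(\<lambda>n. N (\<lambda>x. w n x - g x)) \<longlonglongrightarrow> 0" and ip_g: "\<And>u. u \<in> W \<Longrightarrow> ip u g = ip u v"
  proof (rule riesz_subspace[of W "\<lambda>u. ip u v" "N v"])
    show "ip u v \<le> N v * N u" if "u \<in> W" for u
      using that cauchy_schwarz[of u v] v unfolding W_def by (simp add: mult.commute)
  qed (use v in \<open>auto simp: W_def T_zero T_add T_scale ip_add_left ip_scale_left\<close>)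
  have wV: "w n \<in> V" "T (w n) = (\<lambda>x. 0)" for n
    using w unfolding W_def by auto
  have T_g: "T g = (\<lambda>x. 0)"
  proof
    fix x
    show "T g x = 0"
    proof (cases "x \<in> X")
      case True
      then obtain C where C: "\<And>u. u \<in> V \<Longrightarrow> \<bar>T u x\<bar> \<le> C * N u"
        using T_bounded by blast
      have "\<bar>T g x\<bar> \<le> C * N (\<lambda>x. w n x - g x)" for n
        using C[OF diff_mem[OF wV(1) g]] T_diff[OF wV(1) g] wV(2) by simp
      moreover have "(\<lambda>n. C * N (\<lambda>x. w n x - g x)) \<longlonglongrightarrow> 0"
        using tendsto_mult_right_zero[OF lim] .
      ultimately have "\<bar>T g x\<bar> \<le> 0"
        by (intro LIMSEQ_le_const) auto
      then show ?thesis
        by simp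
    next
      case False
      then show ?thesis
        using T_outside g by blast
    qed
  qed
  show ?thesis
  proof (rule that[of "\<lambda>x. v x - g x"])
    show "(\<lambda>x. v x - g x) \<in> V"
      using v g by (rule diff_mem)
    show "T (\<lambda>x. v x - g x) = T v"
      using T_diff[OF v g] T_g by simp
    show "ip u (\<lambda>x. v x - g x) = 0" if "u \<in> V" "T u = (\<lambda>x. 0)" for u
      using ip_diff_right[OF v g that(1)] ip_g[of u] that unfolding W_def by simp
  qed
qed

text \<open>
  The image of a Hilbert space is isometric to the orthogonal complement of the kernel; this is the
  inverse of that isometry, along which the inner product is transported.
\<close>

definition orthogonal_lift :: "('a \<Rightarrow> real) \<Rightarrow> 'i \<Rightarrow> real" where
  "orthogonal_lift f = (SOME u. u \<in> V \<and> T u = f \<and> (\<forall>w\<in>V. T w = (\<lambda>x. 0) \<longrightarrow> ip w u = 0))"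

lemma orthogonal_lift:
  assumes "f \<in> T ` V"
  shows "orthogonal_lift f \<in> V" "T (orthogonal_lift f) = f"
    "\<And>w. w \<in> V \<Longrightarrow> T w = (\<lambda>x. 0) \<Longrightarrow> ip w (orthogonal_lift f) = 0"
proof -
  have "\<exists>u. u \<in> V \<and> T u = f \<and> (\<forall>w\<in>V. T w = (\<lambda>x. 0) \<longrightarrow> ip w u = 0)"
    using assms orthogonal_representative by (metis imageE)
  from someI_ex[OF this]
  show "orthogonal_lift f \<in> V" "T (orthogonal_lift f) = f"
    "\<And>w. w \<in> V \<Longrightarrow> T w = (\<lambda>x. 0) \<Longrightarrow> ip w (orthogonal_lift f) = 0"
    unfolding orthogonal_lift_def by blast+
qed

lemma orthogonal_lift_unique:
  assumes u: "u \<in> V" and orth: "\<And>w. w \<in> V \<Longrightarrow> T w = (\<lambda>x. 0) \<Longrightarrow> ip w u = 0"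
  shows "orthogonal_lift (T u) = u"
proof -
  note S = orthogonal_lift[OF imageI[OF u]]
  define d where "d = (\<lambda>i. orthogonal_lift (T u) i - u i)"
  have d: "d \<in> V" "T d = (\<lambda>x. 0)"
    unfolding d_def using S(1,2) u T_diff by auto
  have "ip d (orthogonal_lift (T u)) = 0" "ip d u = 0"
    using S(3) orth d by blast+
  moreover have "ip d d = ip d (orthogonal_lift (T u)) - ip d u"
    using ip_diff_right[OF S(1) u d(1)] unfolding d_def .
  ultimately have "N d = 0"
    using ip_self[OF d(1)] by simp
  then have "d = (\<lambda>x. 0)"
    using norm_eq_zero[OF d(1)] by simp
  then show ?thesis
    unfolding d_def by (metis eq_iff_diff_eq_0 ext)
qed

lemma orthogonal_lift_add:
  assumes f: "f \<in> T ` V" and g: "g \<in> T ` V"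
  shows "orthogonal_lift (\<lambda>x. f x + g x) = (\<lambda>i. orthogonal_lift f i + orthogonal_lift g i)"
proof -
  note Sf = orthogonal_lift[OF f] and Sg = orthogonal_lift[OF g]
  have "orthogonal_lift (T (\<lambda>i. orthogonal_lift f i + orthogonal_lift g i)) =
      (\<lambda>i. orthogonal_lift f i + orthogonal_lift g i)"
    using Sf Sg by (intro orthogonal_lift_unique) (simp_all add: add_mem ip_add_right)
  then show ?thesis
    using T_add[OF Sf(1) Sg(1)] Sf(2) Sg(2) by simp
qed

lemma orthogonal_lift_scale:
  assumes f: "f \<in> T ` V"
  shows "orthogonal_lift (\<lambda>x. c * f x) = (\<lambda>i. c * orthogonal_lift f i)"
proof -
  note Sf = orthogonal_lift[OF f]
  have "orthogonal_lift (T (\<lambda>i. c * orthogonal_lift f i)) = (\<lambda>i. c * orthogonal_lift f i)"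
    using Sf by (intro orthogonal_lift_unique) (simp_all add: scale_mem ip_scale_right)
  then show ?thesis
    using T_scale[OF Sf(1)] Sf(2) by simp
qed

lemma quotient_norm_eq:
  assumes f: "f \<in> T ` V"
  shows "quotient_norm f = N (orthogonal_lift f)"
proof -
  note S = orthogonal_lift[OF f]
  have "N (orthogonal_lift f) \<le> N u" if u: "u \<in> V" "T u = T (orthogonal_lift f)" for u
  proof -
    define d where "d = (\<lambda>i. u i - orthogonal_lift f i)"
    have d: "d \<in> V" "T d = (\<lambda>x. 0)"
      unfolding d_def using S(1) u T_diff by auto
    have "(N (\<lambda>i. orthogonal_lift f i + d i))\<^sup>2 = (N (orthogonal_lift f))\<^sup>2 + (N d)\<^sup>2"
      using norm_add_square[OF S(1) d(1)] S(3)[OF d] ip_commute[OF S(1) d(1)] by simp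
    moreover have "(\<lambda>i. orthogonal_lift f i + d i) = u"
      unfolding d_def by simp
    ultimately have "(N (orthogonal_lift f))\<^sup>2 \<le> (N u)\<^sup>2"
      by simp
    then show ?thesis
      using norm_nonneg[OF u(1)] by (rule power2_le_imp_le)
  qed
  then have "N (orthogonal_lift f) \<le> quotient_norm (T (orthogonal_lift f))"
    by (rule quotient_norm_greatest[OF S(1)])
  then show ?thesis
    using quotient_norm_le[OF S(1)] S(2) by simp
qed

lemma hilbert_functions_image:
  "hilbert_functions X (T ` V) quotient_norm (\<lambda>f g. ip (orthogonal_lift f) (orthogonal_lift g))"
proof -
  interpret E: banach_functions X "T ` V" quotient_norm
    by (rule banach_functions_image)
  show ?thesis
    by unfold_locales
      (simp_all add: orthogonal_lift orthogonal_lift_add orthogonal_lift_scale ip_add_left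
        ip_scale_left ip_self quotient_norm_eq ip_commute)
qed

end

section \<open>Reproducing kernel Hilbert spaces\<close>

text \<open>
  A Hilbert space of functions with its reproducing property in place of the dual norm. The kernel is
  cut off outside of \<open>X\<close>, since its values there are arbitrary whereas functions on \<open>X\<close> vanish there.
\<close>

locale rkhs_functions = hilbert_functions X H N ip
  for X :: "'a set" and H N ip +
  fixes k :: "'a \<Rightarrow> 'a \<Rightarrow> real"
  assumes nonempty: "X \<noteq> {}"
    and kernel_section_mem: "x \<in> X \<Longrightarrow> (\<lambda>y. if y \<in> X then k x y else 0) \<in> H"
    and reproducing: "x \<in> X \<Longrightarrow> f \<in> H \<Longrightarrow> ip f (\<lambda>y. if y \<in> X then k x y else 0) = f x"
begin

abbreviation kernel_section :: "'a \<Rightarrow> 'a \<Rightarrow> real" where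
  "kernel_section x \<equiv> (\<lambda>y. if y \<in> X then k x y else 0)"

lemma abs_eval_le: "x \<in> X \<Longrightarrow> f \<in> H \<Longrightarrow> \<bar>f x\<bar> \<le> N (kernel_section x) * N f"
  using cauchy_schwarz[OF _ kernel_section_mem, of f x] reproducing[of x f] by (simp add: mult.commute)

lemma norm_kernel_section_square: "x \<in> X \<Longrightarrow> (N (kernel_section x))\<^sup>2 = k x x"
  using ip_self[OF kernel_section_mem, of x] reproducing[OF _ kernel_section_mem, of x x] by simp

lemma proper_bsf: "proper_bsf X H N"
  using nonempty abs_eval_le by (intro proper_bsfI banach_functions.intro banach) blast+

lemma rkhs_kernel_eq:
  assumes x: "x \<in> X" and y: "y \<in> X"
  shows "rkhs_kernel H N x y = k x y"
proof -
  have "rkhs_kernel H N x y = ip (kernel_section x) (kernel_section y)"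
    unfolding rkhs_kernel_def
    using x y by (intro dual_inner_eq kernel_section_mem) (simp_all add: reproducing)
  also have "\<dots> = k x y"
    using reproducing[OF y kernel_section_mem[OF x]] y by simp
  finally show ?thesis .
qed

lemma rkhs_of_kernel: "rkhs_of_kernel X k H N"
  unfolding rkhs_of_kernel_def rkhs_def using proper_bsf hilbert_norm_on rkhs_kernel_eq by simp

end

text \<open>
  The converse of the preceding lemma. Evaluation functionals have representing vectors by Riesz; the
  kernel, an inner product of functionals, is the inner product of these vectors, which are therefore
  the kernel sections.
\<close>

lemma rkhs_functions_if_rkhs_of_kernel:
  assumes "rkhs_of_kernel X k H N"
  obtains ip where "rkhs_functions X H N ip k"
proof -
  have H: "proper_bsf X H N" "hilbert_norm_on H N"
    and k: "\<And>x y. x \<in> X \<Longrightarrow> y \<in> X \<Longrightarrow> k x y = rkhs_kernel H N x y"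
    using assms unfolding rkhs_of_kernel_def rkhs_def by auto
  have X: "X \<noteq> {}" "banach_function_space X H N"
    using H(1) unfolding proper_bsf_def bsf_def by auto
  obtain ip where "hilbert_functions X H N ip"
    using hilbert_functions_if_hilbert_norm_on[OF X(2) H(2)] .
  then interpret H: hilbert_functions X H N ip .
  have "\<exists>g\<in>H. \<forall>f\<in>H. ip f g = f x" if x: "x \<in> X" for x
  proof -
    obtain C where C: "\<And>f. f \<in> H \<Longrightarrow> \<bar>f x\<bar> \<le> C * N f"
      using proper_bsf_eval_bounded[OF H(1) x] by blast
    obtain g where "g \<in> H" "\<And>f. f \<in> H \<Longrightarrow> ip f g = f x"
    proof (rule H.riesz[of "\<lambda>f. f x" C])
      show "f x \<le> C * N f" if "f \<in> H" for f
        using C[OF that] by simp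
    qed auto
    then show ?thesis
      by blast
  qed
  then obtain K where K: "\<And>x. x \<in> X \<Longrightarrow> K x \<in> H" "\<And>x f. x \<in> X \<Longrightarrow> f \<in> H \<Longrightarrow> ip f (K x) = f x"
    by metis
  have section_eq: "(\<lambda>y. if y \<in> X then k x y else 0) = K x" if x: "x \<in> X" for x
  proof
    fix y
    show "(if y \<in> X then k x y else 0) = K x y"
    proof (cases "y \<in> X")
      case True
      have "rkhs_kernel H N x y = ip (K x) (K y)"
        unfolding rkhs_kernel_def using x True K by (intro H.dual_inner_eq) auto
      then show ?thesis
        using K(2)[OF True K(1)[OF x]] k[OF x True] True by simp
    next
      case False
      then show ?thesis
        using H.outside[OF K(1)[OF x]] by simp
    qed
  qed
  have "rkhs_functions X H N ip k"
    using X(1) K by unfold_locales (auto simp: section_eq)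
  then show ?thesis
    by (rule that)
qed

text \<open>
  On the common subspace \<open>W\<close> of vectors whose two inner products with all functions in \<open>H \<inter> H'\<close> agree,
  the two norms agree. It contains the kernel sections, hence determines all values: for \<open>f \<in> H'\<close> the
  functional \<open>ip' \<cdot> f\<close> on \<open>W\<close> is bounded in the norm of \<open>H\<close>, and the function in \<open>H\<close> that represents it
  has the values of \<open>f\<close>. Taking this \<open>W\<close> instead of the span of the kernel sections avoids finite sums.
\<close>

lemma rkhs_kernel_determines_subset:
  assumes "rkhs_of_kernel X k H N" "rkhs_of_kernel X k H' N'"
  shows "H' \<subseteq> H"
proof
  fix f assume f: "f \<in> H'"
  obtain ip where "rkhs_functions X H N ip k"
    using rkhs_functions_if_rkhs_of_kernel[OF assms(1)] .
  then interpret H: rkhs_functions X H N ip k .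
  obtain ip' where "rkhs_functions X H' N' ip' k"
    using rkhs_functions_if_rkhs_of_kernel[OF assms(2)] .
  then interpret H': rkhs_functions X H' N' ip' k .
  define W where "W = {w \<in> H \<inter> H'. \<forall>h\<in>H \<inter> H'. ip w h = ip' w h}"
  have W: "w \<in> H" "w \<in> H'" "N w = N' w" if w: "w \<in> W" for w
  proof -
    show w': "w \<in> H" "w \<in> H'"
      using w unfolding W_def by auto
    have "(N w)\<^sup>2 = (N' w)\<^sup>2"
      using w H.ip_self[of w] H'.ip_self[of w] unfolding W_def by auto
    then show "N w = N' w"
      using H.norm_nonneg[OF w'(1)] H'.norm_nonneg[OF w'(2)] by (simp add: power2_eq_iff_nonneg)
  qed
  obtain g where g: "g \<in> H" "\<And>w. w \<in> W \<Longrightarrow> ip w g = ip' w f"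
  proof (rule H.riesz_subspace[of W "\<lambda>w. ip' w f" "N' f"])
    show "ip' w f \<le> N' f * N w" if "w \<in> W" for w
      using H'.cauchy_schwarz[of w f] W[OF that] f by (simp add: mult.commute)
    show "(\<lambda>x. 0) \<in> W"
      using H.ip_scale_left[of "\<lambda>x. 0" _ 0] H'.ip_scale_left[of "\<lambda>x. 0" _ 0] unfolding W_def by simp
    show "(\<lambda>x. u x + v x) \<in> W" if "u \<in> W" "v \<in> W" for u v
      using that unfolding W_def by (auto simp: H.ip_add_left H'.ip_add_left)
    show "(\<lambda>x. c * u x) \<in> W" if "u \<in> W" for c u
      using that unfolding W_def by (auto simp: H.ip_scale_left H'.ip_scale_left)
  qed (use W f in \<open>auto simp: H'.ip_add_left H'.ip_scale_left\<close>)
  have "g x = f x" for x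
  proof (cases "x \<in> X")
    case True
    have "ip (H.kernel_section x) h = ip' (H.kernel_section x) h" if "h \<in> H \<inter> H'" for h
      using True that H.reproducing[of x h] H'.reproducing[of x h]
        H.ip_commute[of "H.kernel_section x" h] H'.ip_commute[of "H.kernel_section x" h]
        H.kernel_section_mem H'.kernel_section_mem by simp
    then have section_W: "H.kernel_section x \<in> W"
      unfolding W_def using True H.kernel_section_mem H'.kernel_section_mem by simp
    show ?thesis
      using g(2)[OF section_W] True H.reproducing[OF True g(1)] H'.reproducing[OF True f]
        H.ip_commute[OF H.kernel_section_mem[OF True] g(1)]
        H'.ip_commute[OF H'.kernel_section_mem[OF True] f] by simp
  next
    case False
    then show ?thesis
      using H.outside[OF g(1)] H'.outside[OF f] by simp
  qed
  then have "g = f"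
    by auto
  with g(1) show "f \<in> H"
    by simp
qed

theorem rkhs_kernel_determines:
  assumes "rkhs_of_kernel X k H N" "rkhs_of_kernel X k H' N'"
  shows "H = H'"
  using rkhs_kernel_determines_subset[OF assms] rkhs_kernel_determines_subset[OF assms(2,1)] by blast

text \<open>
  The case of the closed graph theorem that is needed, derived from uniform boundedness. The inner
  products with those \<open>w \<in> H\<close> for which \<open>f \<mapsto> ip w f\<close> is bounded on \<open>E\<close> form a pointwise bounded family
  over the unit ball, hence are uniformly bounded on \<open>E\<close>. Evaluations are bounded on \<open>E\<close>, so these \<open>w\<close>
  include the kernel sections and approximate every \<open>f \<in> H\<close>; the supremum of the family at \<open>f\<close> is thus
  the norm of \<open>f\<close> in \<open>H\<close>.
\<close>

theorem (in rkhs_functions) proper_bsf_subset_embedding: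
  assumes E: "proper_bsf X E NE" and sub: "E \<subseteq> H"
  shows "continuously_embedded E NE H N"
proof -
  interpret E: banach_functions X E NE
    using E unfolding proper_bsf_def bsf_def by unfold_locales simp
  define W where "W = {w \<in> H. \<exists>C. \<forall>f\<in>E. \<bar>ip w f\<bar> \<le> C * NE f}"
  have W_zero: "(\<lambda>x. 0) \<in> W"
    unfolding W_def using ip_scale_left[of "\<lambda>x. 0" _ 0] sub
    by (auto intro!: exI[of _ 0])
  have W_add: "(\<lambda>x. u x + v x) \<in> W" if uv: "u \<in> W" "v \<in> W" for u v
  proof -
    obtain C D where "\<And>f. f \<in> E \<Longrightarrow> \<bar>ip u f\<bar> \<le> C * NE f" "\<And>f. f \<in> E \<Longrightarrow> \<bar>ip v f\<bar> \<le> D * NE f"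
      using uv unfolding W_def by blast
    moreover have H: "u \<in> H" "v \<in> H"
      using uv unfolding W_def by auto
    ultimately have "\<bar>ip (\<lambda>x. u x + v x) f\<bar> \<le> (C + D) * NE f" if "f \<in> E" for f
      using that sub ip_add_left[of u v f] by (fastforce simp: distrib_right)
    then show ?thesis
      unfolding W_def using H by blast
  qed
  have W_scale: "(\<lambda>x. c * u x) \<in> W" if u: "u \<in> W" for c u
  proof -
    obtain C where C: "\<And>f. f \<in> E \<Longrightarrow> \<bar>ip u f\<bar> \<le> C * NE f"
      using u unfolding W_def by blast
    moreover have H: "u \<in> H"
      using u unfolding W_def by auto
    have "\<bar>ip (\<lambda>x. c * u x) f\<bar> \<le> \<bar>c\<bar> * C * NE f" if "f \<in> E" for f
      using mult_left_mono[OF C[OF that], of "\<bar>c\<bar>"] that sub ip_scale_left[of u f c] H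
      by (auto simp: abs_mult)
    then show ?thesis
      unfolding W_def using H by blast
  qed
  have W_section: "kernel_section x \<in> W" if x: "x \<in> X" for x
  proof -
    obtain C where "\<And>f. f \<in> E \<Longrightarrow> \<bar>f x\<bar> \<le> C * NE f"
      using proper_bsf_eval_bounded[OF E x] by blast
    then have "\<forall>f\<in>E. \<bar>ip (kernel_section x) f\<bar> \<le> C * NE f"
      using ip_commute[OF kernel_section_mem[OF x]] reproducing[OF x] sub by auto
    then show ?thesis
      unfolding W_def using kernel_section_mem[OF x] by blast
  qed
  have W_H: "W \<subseteq> H"
    unfolding W_def by blast
  obtain C where C: "\<And>w f. w \<in> {w \<in> W. N w \<le> 1} \<Longrightarrow> f \<in> E \<Longrightarrow> \<bar>ip w f\<bar> \<le> C * NE f"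
  proof (rule E.uniform_boundedness[of "{w \<in> W. N w \<le> 1}" "\<lambda>w f. \<bar>ip w f\<bar>"])
    fix f assume f: "f \<in> E"
    have "\<bar>ip w f\<bar> \<le> N f" if w: "w \<in> {w \<in> W. N w \<le> 1}" for w
    proof -
      have "\<bar>ip w f\<bar> \<le> N w * N f"
        using w W_H f sub by (intro cauchy_schwarz) auto
      also have "\<dots> \<le> 1 * N f"
        using w f sub norm_nonneg by (intro mult_right_mono) auto
      finally show ?thesis
        by simp
    qed
    then show "\<exists>B. \<forall>w\<in>{w \<in> W. N w \<le> 1}. \<bar>ip w f\<bar> \<le> B"
      by blast
  next
    fix w f g assume "w \<in> {w \<in> W. N w \<le> 1}" "f \<in> E" "g \<in> E"
    then have "ip w (\<lambda>x. f x + g x) = ip w f + ip w g"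
      using W_H sub by (intro ip_add_right) auto
    then show "\<bar>ip w (\<lambda>x. f x + g x)\<bar> \<le> \<bar>ip w f\<bar> + \<bar>ip w g\<bar>"
      by simp
  next
    fix w c f assume "w \<in> {w \<in> W. N w \<le> 1}" "f \<in> E"
    then have "ip w (\<lambda>x. c * f x) = c * ip w f"
      using W_H sub by (intro ip_scale_right) auto
    then show "\<bar>ip w (\<lambda>x. c * f x)\<bar> = \<bar>c\<bar> * \<bar>ip w f\<bar>"
      by (simp add: abs_mult)
  qed (auto simp: W_def)
  have bound_W: "ip w f \<le> C * NE f * N w" if w: "w \<in> W" and f: "f \<in> E" for w f
  proof (cases "N w = 0")
    case True
    then have "ip w f = 0"
      using cauchy_schwarz[of w f] w f W_H sub by auto
    then show ?thesis
      using True by simp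
  next
    case False
    then have pos: "0 < N w"
      using norm_nonneg[of w] w W_H by auto
    have "\<bar>ip (\<lambda>x. 1 / N w * w x) f\<bar> \<le> C * NE f"
      using W_scale[OF w, of "1 / N w"] norm_scale[of w "1 / N w"] w W_H pos f by (intro C) auto
    moreover have "ip (\<lambda>x. 1 / N w * w x) f = 1 / N w * ip w f"
      using w f W_H sub by (intro ip_scale_left) auto
    ultimately have "ip w f / N w \<le> C * NE f"
      by (simp only: times_divide_eq_left mult_1_left)
    then show ?thesis
      unfolding pos_divide_le_eq[OF pos] .
  qed
  have bound: "N f \<le> C * NE f" if f: "f \<in> E" for f
  proof -
    have fH: "f \<in> H"
      using f sub by blast
    obtain g w where g: "g \<in> H" and w: "\<And>n::nat. w n \<in> W"
      and lim: "(\<lambda>n. N (\<lambda>x. w n x - g x)) \<longlonglongrightarrow> 0" and ip_g: "\<And>u. u \<in> W \<Longrightarrow> ip u g = ip u f"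
    proof (rule riesz_subspace[of W "\<lambda>u. ip u f" "C * NE f"])
      show "ip u f \<le> C * NE f * N u" if "u \<in> W" for u
        using bound_W[OF that f] .
    qed (use W_H fH W_zero W_add W_scale in \<open>auto simp: ip_add_left ip_scale_left subset_iff\<close>)
    have "g x = f x" for x
    proof (cases "x \<in> X")
      case True
      show ?thesis
        using ip_g[OF W_section[OF True]] reproducing[OF True g] reproducing[OF True fH]
          ip_commute[OF kernel_section_mem[OF True] g] ip_commute[OF kernel_section_mem[OF True] fH]
        by simp
    next
      case False
      then show ?thesis
        using outside[OF g] outside[OF fH] by simp
    qed
    then have gf: "g = f"
      by auto
    have wH: "w n \<in> H" for n
      using w W_H by blast
    \<comment> \<open>Now \<open>f\<close> is a limit of elements of \<open>W\<close>; pass to the limit in the bound of \<open>ip (w n) f\<close>.\<close>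
    have upper: "ip f (w n) \<le> C * NE f * (N f + N (\<lambda>x. w n x - f x))" for n
    proof -
      have "0 \<le> C * NE f"
      proof -
        have "\<bar>ip (\<lambda>x. 0) f\<bar> \<le> C * NE f"
          using W_zero f by (intro C) auto
        then show ?thesis
          by linarith
      qed
      then have "C * NE f * N (w n) \<le> C * NE f * (N f + N (\<lambda>x. w n x - f x))"
        using norm_le_add_diff[OF wH fH] by (intro mult_left_mono)
      then show ?thesis
        using bound_W[OF w f, of n] ip_commute[OF wH fH, of n] by linarith
    qed
    have ip_lim: "(\<lambda>n. ip f (w n)) \<longlonglongrightarrow> ip f f"
      using ip_tendsto[OF wH fH _ fH] lim unfolding gf .
    have upper_lim: "(\<lambda>n. C * NE f * (N f + N (\<lambda>x. w n x - f x))) \<longlonglongrightarrow> C * NE f * (N f + 0)"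
      using lim unfolding gf by (intro tendsto_intros)
    have "ip f f \<le> C * NE f * (N f + 0)"
      using LIMSEQ_le[OF ip_lim upper_lim] upper by blast
    then have le: "N f * N f \<le> C * NE f * N f"
      using ip_self[OF fH] by (simp add: power2_eq_square)
    show ?thesis
    proof (cases "N f = 0")
      case True
      then have "f = (\<lambda>x. 0)"
        using norm_eq_zero[OF fH] by simp
      then show ?thesis
        using E.norm_zero True by simp
    next
      case False
      then have "0 < N f"
        using norm_nonneg[OF fH] by simp
      with le show ?thesis
        using mult_le_cancel_right_pos by blast
    qed
  qed
  have "\<exists>d>0. \<forall>g\<in>E. ndist NE g f < d \<longrightarrow> ndist N g f < e" if "f \<in> E" "0 < e" for f e
    using E.continuous_if_bounded[of N C, OF bound that] by (simp add: ndist_def)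
  then show ?thesis
    unfolding continuously_embedded_def using sub by blast
qed

section \<open>The reproducing kernel Hilbert space of a sum of kernels\<close>

text \<open>
  Each feature is orthogonal to all vectors mapped to zero, so it is its own orthogonal lift; this is
  the reproducing property of the image.
\<close>

theorem (in hilbert_functions) rkhs_of_feature_map:
  assumes X: "X \<noteq> {}" and \<Phi>: "\<And>x. x \<in> X \<Longrightarrow> \<Phi> x \<in> V"
  shows "\<exists>N'. rkhs_of_kernel X (\<lambda>x y. ip (\<Phi> x) (\<Phi> y))
    ((\<lambda>v x. if x \<in> X then ip v (\<Phi> x) else 0) ` V) N'"
proof -
  define T where "T v = (\<lambda>x. if x \<in> X then ip v (\<Phi> x) else 0)" for v
  have T_apply: "T v x = (if x \<in> X then ip v (\<Phi> x) else 0)" for v x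
    unfolding T_def ..
  interpret hilbert_operator I V N ip X T
  proof
    show "\<exists>C. \<forall>v\<in>V. \<bar>T v x\<bar> \<le> C * N v" if "x \<in> X" for x
      using cauchy_schwarz \<Phi>[OF that] that unfolding T_def
      by (intro exI[of _ "N (\<Phi> x)"]) (auto simp: mult.commute)
  qed (use X \<Phi> in \<open>auto simp: T_def ip_add_left ip_scale_left\<close>)
  have lift: "orthogonal_lift (T (\<Phi> x)) = \<Phi> x" if x: "x \<in> X" for x
  proof (rule orthogonal_lift_unique[OF \<Phi>[OF x]])
    fix w assume "w \<in> V" and 0: "T w = (\<lambda>x. 0)"
    show "ip w (\<Phi> x) = 0"
      using fun_cong[OF 0, of x] x unfolding T_def by simp
  qed
  interpret image: hilbert_functions X "T ` V" quotient_norm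
    "\<lambda>f g. ip (orthogonal_lift f) (orthogonal_lift g)"
    by (rule hilbert_functions_image)
  interpret image: rkhs_functions X "T ` V" quotient_norm
    "\<lambda>f g. ip (orthogonal_lift f) (orthogonal_lift g)" "\<lambda>x y. ip (\<Phi> x) (\<Phi> y)"
  proof
    show "X \<noteq> {}"
      by (rule X)
    fix x assume x: "x \<in> X"
    have kernel_section: "(\<lambda>y. if y \<in> X then ip (\<Phi> x) (\<Phi> y) else 0) = T (\<Phi> x)"
      unfolding T_def ..
    then show "(\<lambda>y. if y \<in> X then ip (\<Phi> x) (\<Phi> y) else 0) \<in> T ` V"
      using \<Phi>[OF x] by simp
    fix f assume f: "f \<in> T ` V"
    have "ip (orthogonal_lift f) (orthogonal_lift (T (\<Phi> x))) = T (orthogonal_lift f) x"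
      using x by (simp only: lift T_apply if_True)
    then show "ip (orthogonal_lift f) (orthogonal_lift (\<lambda>y. if y \<in> X then ip (\<Phi> x) (\<Phi> y) else 0)) = f x"
      unfolding kernel_section orthogonal_lift(2)[OF f] .
  qed
  show ?thesis
    using image.rkhs_of_kernel unfolding T_def by blast
qed

text \<open>
  Pairs \<open>(f, g)\<close> as functions on the disjoint sum of the index sets, so that the Hilbert sum is again
  a space of functions.
\<close>

definition direct_sum :: "('i \<Rightarrow> real) set \<Rightarrow> ('j \<Rightarrow> real) set \<Rightarrow> ('i + 'j \<Rightarrow> real) set" where
  "direct_sum V W = {v. (\<lambda>i. v (Inl i)) \<in> V \<and> (\<lambda>j. v (Inr j)) \<in> W}"

theorem hilbert_functions_direct_sum:
  assumes "hilbert_functions I V N ip" "hilbert_functions J W M ip'"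
  shows "hilbert_functions (I <+> J) (direct_sum V W)
    (\<lambda>v. sqrt ((N (\<lambda>i. v (Inl i)))\<^sup>2 + (M (\<lambda>j. v (Inr j)))\<^sup>2))
    (\<lambda>u v. ip (\<lambda>i. u (Inl i)) (\<lambda>i. v (Inl i)) + ip' (\<lambda>j. u (Inr j)) (\<lambda>j. v (Inr j)))"
proof -
  interpret V: hilbert_functions I V N ip by fact
  interpret W: hilbert_functions J W M ip' by fact
  let ?N = "\<lambda>v. sqrt ((N (\<lambda>i. v (Inl i)))\<^sup>2 + (M (\<lambda>j. v (Inr j)))\<^sup>2)"
  have memD: "(\<lambda>i. v (Inl i)) \<in> V" "(\<lambda>j. v (Inr j)) \<in> W" if "v \<in> direct_sum V W" for v
    using that unfolding direct_sum_def by auto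
  have space: "function_space (I <+> J) (direct_sum V W)"
    unfolding function_space_def
  proof (intro conjI subsetI)
    fix v assume v: "v \<in> direct_sum V W"
    have "v z = 0" if z: "z \<notin> I <+> J" for z
    proof (cases z)
      case (Inl i)
      then show ?thesis
        using V.outside[OF memD(1)[OF v], of i] z by auto
    next
      case (Inr j)
      then show ?thesis
        using W.outside[OF memD(2)[OF v], of j] z by auto
    qed
    then show "v \<in> functions_on (I <+> J)"
      unfolding functions_on_def by blast
  qed (auto simp: direct_sum_def)
  have norm: "is_norm_on (direct_sum V W) ?N"
    unfolding is_norm_on_def
  proof (intro conjI ballI allI)
    fix v assume v: "v \<in> direct_sum V W"
    show "?N v = 0 \<longleftrightarrow> v = (\<lambda>z. 0)"
    proof
      assume "?N v = 0"
      then have "N (\<lambda>i. v (Inl i)) = 0" "M (\<lambda>j. v (Inr j)) = 0"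
        by (simp_all add: sum_power2_eq_zero_iff)
      then have 0: "(\<lambda>i. v (Inl i)) = (\<lambda>i. 0)" "(\<lambda>j. v (Inr j)) = (\<lambda>j. 0)"
        using V.norm_eq_zero[OF memD(1)[OF v]] W.norm_eq_zero[OF memD(2)[OF v]] by auto
      show "v = (\<lambda>z. 0)"
      proof
        fix z
        show "v z = 0"
          using fun_cong[OF 0(1)] fun_cong[OF 0(2)] by (cases z) auto
      qed
    qed simp
    show "?N (\<lambda>z. c * v z) = \<bar>c\<bar> * ?N v" for c
    proof -
      have "?N (\<lambda>z. c * v z) = sqrt (c\<^sup>2 * ((N (\<lambda>i. v (Inl i)))\<^sup>2 + (M (\<lambda>j. v (Inr j)))\<^sup>2))"
        using V.norm_scale[OF memD(1)[OF v], of c] W.norm_scale[OF memD(2)[OF v], of c]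
        by (simp add: power_mult_distrib distrib_left)
      then show ?thesis
        by (simp add: real_sqrt_mult)
    qed
    fix u assume u: "u \<in> direct_sum V W"
    have "?N (\<lambda>z. v z + u z) \<le> sqrt ((N (\<lambda>i. v (Inl i)) + N (\<lambda>i. u (Inl i)))\<^sup>2
        + (M (\<lambda>j. v (Inr j)) + M (\<lambda>j. u (Inr j)))\<^sup>2)"
      using V.norm_triangle[OF memD(1)[OF v] memD(1)[OF u]] W.norm_triangle[OF memD(2)[OF v] memD(2)[OF u]]
        V.norm_nonneg[OF V.add_mem[OF memD(1)[OF v] memD(1)[OF u]]]
        W.norm_nonneg[OF W.add_mem[OF memD(2)[OF v] memD(2)[OF u]]]
      by (intro real_sqrt_le_mono add_mono power_mono)
    also have "\<dots> \<le> ?N v + ?N u"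
      by (rule real_sqrt_sum_squares_triangle_ineq)
    finally show "?N (\<lambda>z. v z + u z) \<le> ?N v + ?N u" .
  qed simp
  have complete: "complete_norm_on (direct_sum V W) ?N"
    unfolding complete_norm_on_def ndist_def
  proof (intro allI impI, elim conjE)
    fix s :: "nat \<Rightarrow> _"
    assume "range s \<subseteq> direct_sum V W"
      and cauchy: "\<forall>e>0. \<exists>n0. \<forall>m\<ge>n0. \<forall>n\<ge>n0. ?N (\<lambda>z. s m z - s n z) < e"
    then have s: "s n \<in> direct_sum V W" for n
      by blast
    have le: "N (\<lambda>i. v (Inl i)) \<le> ?N v" "M (\<lambda>j. v (Inr j)) \<le> ?N v" for v
      by (simp_all add: real_le_rsqrt)
    have cauchyV: "\<exists>n0. \<forall>m\<ge>n0. \<forall>n\<ge>n0. N (\<lambda>i. s m (Inl i) - s n (Inl i)) < e" if "0 < e" for e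
      using cauchy that le(1) by (meson le_less_trans)
    have cauchyW: "\<exists>n0. \<forall>m\<ge>n0. \<forall>n\<ge>n0. M (\<lambda>j. s m (Inr j) - s n (Inr j)) < e" if "0 < e" for e
      using cauchy that le(2) by (meson le_less_trans)
    obtain f where f: "f \<in> V" "(\<lambda>n. N (\<lambda>i. s n (Inl i) - f i)) \<longlonglongrightarrow> 0"
      using V.complete[OF memD(1)[OF s] cauchyV] by blast
    obtain g where g: "g \<in> W" "(\<lambda>n. M (\<lambda>j. s n (Inr j) - g j)) \<longlonglongrightarrow> 0"
      using W.complete[OF memD(2)[OF s] cauchyW] by blast
    have "(\<lambda>n. sqrt ((N (\<lambda>i. s n (Inl i) - f i))\<^sup>2 + (M (\<lambda>j. s n (Inr j) - g j))\<^sup>2)) \<longlonglongrightarrow> sqrt (0\<^sup>2 + 0\<^sup>2)"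
      using f(2) g(2) by (intro tendsto_intros)
    then have "(\<lambda>n. ?N (\<lambda>z. s n z - case_sum f g z)) \<longlonglongrightarrow> 0"
      by simp
    moreover have "case_sum f g \<in> direct_sum V W"
      unfolding direct_sum_def using f(1) g(1) by simp
    ultimately show "\<exists>f\<in>direct_sum V W. (\<lambda>n. ?N (\<lambda>z. s n z - f z)) \<longlonglongrightarrow> 0"
      by blast
  qed
  show ?thesis
  proof
    show "banach_function_space (I <+> J) (direct_sum V W) ?N"
      unfolding banach_function_space_def using space norm complete by blast
  qed (auto simp: direct_sum_def V.ip_commute W.ip_commute V.ip_add_left W.ip_add_left
      V.ip_scale_left W.ip_scale_left V.ip_self W.ip_self distrib_left)
qed

text \<open>
  Addition \<open>(f, g) \<mapsto> f + g\<close> on the Hilbert sum comes from the feature map that pairs the two kernel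
  sections.
\<close>

theorem rkhs_of_sum_of_kernels:
  assumes "rkhs_of_kernel X k1 H1 N1" "rkhs_of_kernel X k2 H2 N2"
  shows "\<exists>N. rkhs_of_kernel X (\<lambda>x y. k1 x y + k2 x y) (function_set_sum H1 H2) N"
proof -
  obtain ip1 where "rkhs_functions X H1 N1 ip1 k1"
    using rkhs_functions_if_rkhs_of_kernel[OF assms(1)] .
  then interpret H1: rkhs_functions X H1 N1 ip1 k1 .
  obtain ip2 where "rkhs_functions X H2 N2 ip2 k2"
    using rkhs_functions_if_rkhs_of_kernel[OF assms(2)] .
  then interpret H2: rkhs_functions X H2 N2 ip2 k2 .
  define ip where "ip u v = ip1 (\<lambda>x. u (Inl x)) (\<lambda>x. v (Inl x)) + ip2 (\<lambda>x. u (Inr x)) (\<lambda>x. v (Inr x))"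
    for u v :: "'a + 'a \<Rightarrow> real"
  define \<Phi> where "\<Phi> x = case_sum (H1.kernel_section x) (H2.kernel_section x)" for x
  have ip_\<Phi>: "ip v (\<Phi> x) = v (Inl x) + v (Inr x)" if "x \<in> X" "v \<in> direct_sum H1 H2" for x v
    using that H1.reproducing[of x "\<lambda>x. v (Inl x)"] H2.reproducing[of x "\<lambda>x. v (Inr x)"]
    unfolding ip_def \<Phi>_def direct_sum_def by simp
  have \<Phi>_mem: "\<Phi> x \<in> direct_sum H1 H2" if "x \<in> X" for x
    unfolding \<Phi>_def direct_sum_def using H1.kernel_section_mem[OF that] H2.kernel_section_mem[OF that] by simp
  have "hilbert_functions (X <+> X) (direct_sum H1 H2)
      (\<lambda>v. sqrt ((N1 (\<lambda>x. v (Inl x)))\<^sup>2 + (N2 (\<lambda>x. v (Inr x)))\<^sup>2)) ip"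
    unfolding ip_def
    by (intro hilbert_functions_direct_sum H1.hilbert_functions_axioms H2.hilbert_functions_axioms)
  from hilbert_functions.rkhs_of_feature_map[OF this H1.nonempty, of \<Phi>] \<Phi>_mem
  obtain N where N: "rkhs_of_kernel X (\<lambda>x y. ip (\<Phi> x) (\<Phi> y))
      ((\<lambda>v x. if x \<in> X then ip v (\<Phi> x) else 0) ` direct_sum H1 H2) N"
    by blast
  have "(if x \<in> X then ip v (\<Phi> x) else 0) = v (Inl x) + v (Inr x)" if v: "v \<in> direct_sum H1 H2" for v x
    using ip_\<Phi>[OF _ v] H1.outside[of "\<lambda>x. v (Inl x)" x] H2.outside[of "\<lambda>x. v (Inr x)" x] v
    unfolding direct_sum_def by auto
  then have "(\<lambda>v x. if x \<in> X then ip v (\<Phi> x) else 0) ` direct_sum H1 H2 =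
      (\<lambda>v x. v (Inl x) + v (Inr x)) ` direct_sum H1 H2"
    by (intro image_cong ext refl)
  also have "\<dots> = function_set_sum H1 H2"
  proof (intro equalityI subsetI)
    fix h assume "h \<in> function_set_sum H1 H2"
    then obtain f g where fg: "f \<in> H1" "g \<in> H2" "h = (\<lambda>x. f x + g x)"
      unfolding function_set_sum_def by blast
    then have "case_sum f g \<in> direct_sum H1 H2" "h = (\<lambda>x. case_sum f g (Inl x) + case_sum f g (Inr x))"
      unfolding direct_sum_def by simp_all
    then show "h \<in> (\<lambda>v x. v (Inl x) + v (Inr x)) ` direct_sum H1 H2"
      by blast
  qed (auto simp: direct_sum_def function_set_sum_def)
  finally have image: "(\<lambda>v x. if x \<in> X then ip v (\<Phi> x) else 0) ` direct_sum H1 H2 = function_set_sum H1 H2" .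
  have kernel: "ip (\<Phi> x) (\<Phi> y) = k1 x y + k2 x y" if "x \<in> X" "y \<in> X" for x y
    using ip_\<Phi>[OF that(2) \<Phi>_mem[OF that(1)]] that(2) unfolding \<Phi>_def by simp
  have "rkhs_of_kernel X (\<lambda>x y. k1 x y + k2 x y) (function_set_sum H1 H2) N"
    using N kernel unfolding image rkhs_of_kernel_def by simp
  then show ?thesis
    by blast
qed

section \<open>Finite signed measures\<close>

lemma finite_signed_measures_split:
  assumes \<mu>: "\<mu> \<in> finite_signed_measures X" and AB: "A \<in> sets X" "B \<in> sets X"
  shows "\<mu> A = \<mu> (A \<inter> B) + \<mu> (A - B)"
  using finite_signed_measures_Un[OF \<mu>, of "A \<inter> B" "A - B"] AB by (simp add: Int_Diff_Un Int_Diff_disjoint)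

lemma finite_signed_measures_scale:
  assumes \<mu>: "\<mu> \<in> finite_signed_measures X"
  shows "(\<lambda>A. c * \<mu> A) \<in> finite_signed_measures X"
  using \<mu> unfolding finite_signed_measures_def functions_on_def by (auto intro: sums_mult)

lemma finite_signed_measures_minus:
  "\<mu> \<in> finite_signed_measures X \<Longrightarrow> (\<lambda>A. - \<mu> A) \<in> finite_signed_measures X"
  using finite_signed_measures_scale[of \<mu> X "-1"] by simp

text \<open>
  If \<open>\<mu>\<close> is unbounded on the subsets of \<open>E\<close>, then \<open>E\<close> splits into a part on whose subsets \<open>\<mu>\<close> is still
  unbounded and a part of measure at least 1 in modulus. Iterating this yields infinitely many disjoint
  sets of the second kind, against countable additivity.
\<close>

theorem finite_signed_measures_bounded:
  assumes \<mu>: "\<mu> \<in> finite_signed_measures X"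
  obtains B where "\<And>A. A \<in> sets X \<Longrightarrow> \<bar>\<mu> A\<bar> \<le> B"
proof -
  define unb where "unb E \<longleftrightarrow> (\<forall>B. \<exists>A\<in>sets X. A \<subseteq> E \<and> B < \<bar>\<mu> A\<bar>)" for E
  have step: "\<exists>F. (F \<in> sets X \<and> unb F) \<and> F \<subseteq> E \<and> 1 \<le> \<bar>\<mu> (E - F)\<bar>"
    if E: "E \<in> sets X \<and> unb E" for E
  proof -
    obtain A where A: "A \<in> sets X" "A \<subseteq> E" "1 + \<bar>\<mu> E\<bar> < \<bar>\<mu> A\<bar>"
      using E unfolding unb_def by blast
    have "\<mu> E = \<mu> A + \<mu> (E - A)"
      using finite_signed_measures_split[OF \<mu>, of E A] A E by (simp add: Int_absorb1)
    then have large: "1 \<le> \<bar>\<mu> (E - A)\<bar>" "1 \<le> \<bar>\<mu> A\<bar>"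
      using A(3) by linarith+
    have "unb A \<or> unb (E - A)"
    proof (rule ccontr)
      assume "\<not> (unb A \<or> unb (E - A))"
      then obtain B C where B: "\<forall>D\<in>sets X. D \<subseteq> A \<longrightarrow> \<bar>\<mu> D\<bar> \<le> B"
        and C: "\<forall>D\<in>sets X. D \<subseteq> E - A \<longrightarrow> \<bar>\<mu> D\<bar> \<le> C"
        by (auto simp: unb_def not_less)
      obtain D where D: "D \<in> sets X" "D \<subseteq> E" "B + C < \<bar>\<mu> D\<bar>"
        using E unfolding unb_def by blast
      have "D \<inter> A \<in> sets X" "D - A \<in> sets X" "D - A \<subseteq> E - A"
        using A(1) D(1,2) by auto
      then have "\<bar>\<mu> (D \<inter> A)\<bar> \<le> B" "\<bar>\<mu> (D - A)\<bar> \<le> C"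
        using B C by simp_all
      then show False
        using finite_signed_measures_split[OF \<mu> D(1) A(1)] D(3) by linarith
    qed
    then show ?thesis
    proof
      assume "unb A"
      then show ?thesis
        using A large by blast
    next
      assume "unb (E - A)"
      moreover have "E - (E - A) = A"
        using A(2) by blast
      ultimately show ?thesis
        using A E large by (intro exI[of _ "E - A"]) auto
    qed
  qed
  have "\<not> unb (space X)"
  proof
    assume "unb (space X)"
    then have "\<exists>E. E \<in> sets X \<and> unb E"
      by blast
    then have "\<exists>E. \<forall>n::nat. (E n \<in> sets X \<and> unb (E n)) \<and>
        E (Suc n) \<subseteq> E n \<and> 1 \<le> \<bar>\<mu> (E n - E (Suc n))\<bar>"
      by (rule dependent_nat_choice[of "\<lambda>_ E. E \<in> sets X \<and> unb E"
            "\<lambda>_ E F. F \<subseteq> E \<and> 1 \<le> \<bar>\<mu> (E - F)\<bar>"]) (rule step)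
    then obtain E where "\<forall>n::nat. (E n \<in> sets X \<and> unb (E n)) \<and>
        E (Suc n) \<subseteq> E n \<and> 1 \<le> \<bar>\<mu> (E n - E (Suc n))\<bar>"
      by blast
    then have E: "E n \<in> sets X" and dec: "E (Suc n) \<subseteq> E n" "1 \<le> \<bar>\<mu> (E n - E (Suc n))\<bar>" for n
      by auto
    have "decseq E"
      using dec(1) by (rule decseq_SucI)
    have disj: "disjoint_family (\<lambda>n. E n - E (Suc n))"
      unfolding disjoint_family_on_def
    proof (intro ballI impI)
      fix m n :: nat assume "m \<noteq> n"
      then have "Suc m \<le> n \<or> Suc n \<le> m"
        by linarith
      then show "(E m - E (Suc m)) \<inter> (E n - E (Suc n)) = {}"
        using decseqD[OF \<open>decseq E\<close>, of "Suc m" n] decseqD[OF \<open>decseq E\<close>, of "Suc n" m] by blast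
    qed
    have "summable (\<lambda>n. \<mu> (E n - E (Suc n)))"
      using finite_signed_measuresD[OF \<mu> _ disj] E by (intro sums_summable) auto
    then have "(\<lambda>n. \<mu> (E n - E (Suc n))) \<longlonglongrightarrow> 0"
      by (rule summable_LIMSEQ_zero)
    from LIMSEQ_D[OF this zero_less_one] obtain n where "norm (\<mu> (E n - E (Suc n)) - 0) < 1"
      by blast
    then show False
      using dec(2)[of n] by simp
  qed
  then obtain B where B: "\<forall>A\<in>sets X. A \<subseteq> space X \<longrightarrow> \<bar>\<mu> A\<bar> \<le> B"
    by (auto simp: unb_def not_less)
  show ?thesis
  proof (rule that)
    show "\<bar>\<mu> A\<bar> \<le> B" if "A \<in> sets X" for A
      using B that sets.sets_into_space[OF that] by simp
  qed
qed

lemma sets_positive_variation [simp, measurable_cong]: "sets (positive_variation X \<mu>) = sets X"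
  unfolding positive_variation_def by (rule sets.sets_measure_of_eq)

lemma space_positive_variation [simp]: "space (positive_variation X \<mu>) = space X"
  by (rule sets_eq_imp_space_eq) simp

lemma sets_negative_variation [simp, measurable_cong]: "sets (negative_variation X \<mu>) = sets X"
  unfolding negative_variation_def by simp

lemma space_negative_variation [simp]: "space (negative_variation X \<mu>) = space X"
  unfolding negative_variation_def by simp

lemma finite_positive_variation:
  assumes \<mu>: "\<mu> \<in> finite_signed_measures X"
  shows "finite_measure (positive_variation X \<mu>)"
proof
  obtain B where B: "\<And>A. A \<in> sets X \<Longrightarrow> \<bar>\<mu> A\<bar> \<le> B"
    using finite_signed_measures_bounded[OF \<mu>] by blast
  have "emeasure (positive_variation X \<mu>) (space X) \<le> ennreal B"
    unfolding emeasure_positive_variation[OF \<mu> sets.top]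
  proof (intro SUP_least ennreal_leI)
    show "\<mu> A \<le> B" if "A \<in> {B \<in> sets X. B \<subseteq> space X}" for A
      using B[of A] that by auto
  qed
  also have "\<dots> < \<infinity>"
    by simp
  finally show "emeasure (positive_variation X \<mu>) (space (positive_variation X \<mu>)) \<noteq> \<infinity>"
    by simp
qed

lemma finite_negative_variation:
  "\<mu> \<in> finite_signed_measures X \<Longrightarrow> finite_measure (negative_variation X \<mu>)"
  unfolding negative_variation_def by (intro finite_positive_variation finite_signed_measures_minus)

lemma positive_variation_upper:
  assumes \<mu>: "\<mu> \<in> finite_signed_measures X" and AB: "A \<in> sets X" "B \<in> sets X" "B \<subseteq> A"
  shows "\<mu> B \<le> measure (positive_variation X \<mu>) A"
proof -
  interpret finite_measure "positive_variation X \<mu>"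
    by (rule finite_positive_variation[OF \<mu>])
  have "ennreal (\<mu> B) \<le> emeasure (positive_variation X \<mu>) A"
    unfolding emeasure_positive_variation[OF \<mu> AB(1)] using AB by (intro SUP_upper) auto
  then show ?thesis
    unfolding emeasure_eq_measure by (simp add: ennreal_le_iff)
qed

lemma positive_variation_least:
  assumes \<mu>: "\<mu> \<in> finite_signed_measures X" and A: "A \<in> sets X"
    and b: "\<And>B. B \<in> sets X \<Longrightarrow> B \<subseteq> A \<Longrightarrow> \<mu> B \<le> b"
  shows "measure (positive_variation X \<mu>) A \<le> b"
proof -
  interpret finite_measure "positive_variation X \<mu>"
    by (rule finite_positive_variation[OF \<mu>])
  have "0 \<le> b"
    using b[of "{}"] finite_signed_measures_empty[OF \<mu>] by simp
  have "emeasure (positive_variation X \<mu>) A \<le> ennreal b"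
    unfolding emeasure_positive_variation[OF \<mu> A] using b by (intro SUP_least ennreal_leI) auto
  then show ?thesis
    unfolding emeasure_eq_measure using \<open>0 \<le> b\<close> by (simp add: ennreal_le_iff)
qed

text \<open>
  Complements exchange the two suprema: for \<open>B \<subseteq> A\<close>, \<open>\<mu> B = \<mu> A - \<mu> (A - B)\<close>.
\<close>

theorem jordan_decomposition:
  assumes \<mu>: "\<mu> \<in> finite_signed_measures X" and A: "A \<in> sets X"
  shows "\<mu> A = measure (positive_variation X \<mu>) A - measure (negative_variation X \<mu>) A"
proof -
  note \<mu>' = finite_signed_measures_minus[OF \<mu>]
  have split: "\<mu> A = \<mu> B + \<mu> (A - B)" if "B \<in> sets X" "B \<subseteq> A" for B
    using finite_signed_measures_split[OF \<mu> A that(1)] that(2) by (simp add: Int_absorb1)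
  have "measure (positive_variation X \<mu>) A \<le> \<mu> A + measure (negative_variation X \<mu>) A"
  proof (rule positive_variation_least[OF \<mu> A])
    fix B assume B: "B \<in> sets X" "B \<subseteq> A"
    then show "\<mu> B \<le> \<mu> A + measure (negative_variation X \<mu>) A"
      using split[OF B] positive_variation_upper[OF \<mu>' A, of "A - B"] A
      unfolding negative_variation_def by auto
  qed
  moreover have "measure (negative_variation X \<mu>) A \<le> measure (positive_variation X \<mu>) A - \<mu> A"
    unfolding negative_variation_def
  proof (rule positive_variation_least[OF \<mu>' A])
    fix B assume B: "B \<in> sets X" "B \<subseteq> A"
    then show "- \<mu> B \<le> measure (positive_variation X \<mu>) A - \<mu> A"
      using split[OF B] positive_variation_upper[OF \<mu> A, of "A - B"] A by auto
  qed
  ultimately show ?thesis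
    by linarith
qed

section \<open>Sums of measures and signed integrals\<close>

text \<open>
  Additivity of signed integrals in the measure is reduced to sums of positive measures: if
  \<open>P - Q = \<mu>\<^sup>+ - \<mu>\<^sup>-\<close>, then \<open>P + \<mu>\<^sup>- = \<mu>\<^sup>+ + Q\<close>. The total variation is such a sum, too.
\<close>

definition add_measure :: "'a measure \<Rightarrow> 'a measure \<Rightarrow> 'a measure" where
  "add_measure M N = measure_of (space M) (sets M) (\<lambda>A. emeasure M A + emeasure N A)"

lemma sets_add_measure [simp, measurable_cong]: "sets (add_measure M N) = sets M"
  unfolding add_measure_def by (rule sets.sets_measure_of_eq)

lemma space_add_measure [simp]: "space (add_measure M N) = space M"
  by (rule sets_eq_imp_space_eq) simp

lemma emeasure_add_measure:
  assumes sets: "sets N = sets M" and A: "A \<in> sets M"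
  shows "emeasure (add_measure M N) A = emeasure M A + emeasure N A"
  unfolding add_measure_def
proof (rule emeasure_measure_of_sigma[OF sets.sigma_algebra_axioms])
  show "positive (sets M) (\<lambda>A. emeasure M A + emeasure N A)"
    by (simp add: positive_def)
  show "countably_additive (sets M) (\<lambda>A. emeasure M A + emeasure N A)"
  proof (rule countably_additiveI)
    fix A :: "nat \<Rightarrow> 'a set" assume A: "range A \<subseteq> sets M" "disjoint_family A"
    have "(\<Sum>n. emeasure M (A n) + emeasure N (A n)) = (\<Sum>n. emeasure M (A n)) + (\<Sum>n. emeasure N (A n))"
      by (rule suminf_add[symmetric]) auto
    then show "(\<Sum>n. emeasure M (A n) + emeasure N (A n)) = emeasure M (\<Union>n. A n) + emeasure N (\<Union>n. A n)"
      using A by (simp add: suminf_emeasure sets)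
  qed
qed (rule A)

lemma nn_integral_add_measure:
  assumes f: "f \<in> borel_measurable M" and sets: "sets N = sets M"
  shows "(\<integral>\<^sup>+x. f x \<partial>add_measure M N) = (\<integral>\<^sup>+x. f x \<partial>M) + (\<integral>\<^sup>+x. f x \<partial>N)"
proof -
  note [measurable_cong] = sets
  note [simp] = sets_eq_imp_space_eq[OF sets]
  show ?thesis
    using f
  proof (induction rule: borel_measurable_induct)
    case (cong f g)
    have "(\<integral>\<^sup>+x. f x \<partial>K) = (\<integral>\<^sup>+x. g x \<partial>K)" if "space K = space M" for K
      using cong(3) that by (intro nn_integral_cong) auto
    then show ?case
      using cong(4) by simp
  next
    case (set A)
    then show ?case
      by (simp add: emeasure_add_measure[OF sets] sets)
  next
    case (mult u c)
    then show ?case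
      by (simp add: nn_integral_cmult distrib_left measurable_cong_sets[OF sets refl]
          measurable_cong_sets[OF sets_add_measure refl])
  next
    case (add u v)
    then show ?case
      by (simp add: nn_integral_add ac_simps measurable_cong_sets[OF sets refl]
          measurable_cong_sets[OF sets_add_measure refl])
  next
    case (seq U)
    have mono: "incseq (\<lambda>i. \<integral>\<^sup>+x. U i x \<partial>K)" for K
      using seq.hyps(3) by (auto simp: incseq_def le_fun_def intro!: nn_integral_mono)
    have "(\<integral>\<^sup>+x. (SUP i. U i) x \<partial>K) = (SUP i. \<integral>\<^sup>+x. U i x \<partial>K)" if "sets K = sets M" for K
      using nn_integral_monotone_convergence_SUP[OF seq.hyps(3), of K] seq.hyps(1) that
      by (simp add: image_comp measurable_cong_sets[OF that refl])
    then show ?case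
      using seq.IH ennreal_SUP_add[OF mono mono, of M N] by (simp add: sets)
  qed
qed

lemma integrable_add_measure:
  fixes f :: "'a \<Rightarrow> real"
  assumes sets: "sets N = sets M"
  shows "integrable (add_measure M N) f \<longleftrightarrow> integrable M f \<and> integrable N f"
proof (cases "f \<in> borel_measurable M")
  case True
  then show ?thesis
    using nn_integral_add_measure[OF _ sets, of "\<lambda>x. ennreal (norm (f x))"]
    by (auto simp: integrable_iff_bounded measurable_cong_sets[OF sets refl]
        measurable_cong_sets[OF sets_add_measure refl])
next
  case False
  then show ?thesis
    by (auto simp: integrable_iff_bounded measurable_cong_sets[OF sets_add_measure refl])
qed

lemma integral_add_measure:
  fixes f :: "'a \<Rightarrow> real"
  assumes sets: "sets N = sets M" and f: "integrable M f" "integrable N f"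
  shows "(\<integral>x. f x \<partial>add_measure M N) = (\<integral>x. f x \<partial>M) + (\<integral>x. f x \<partial>N)"
proof -
  have "enn2real (\<integral>\<^sup>+x. ennreal (g x) \<partial>add_measure M N) =
      enn2real (\<integral>\<^sup>+x. ennreal (g x) \<partial>M) + enn2real (\<integral>\<^sup>+x. ennreal (g x) \<partial>N)"
    if g: "integrable M g" "integrable N g" for g :: "'a \<Rightarrow> real"
  proof -
    have "(\<integral>\<^sup>+x. ennreal (g x) \<partial>M) < top" "(\<integral>\<^sup>+x. ennreal (g x) \<partial>N) < top"
      using g by (auto simp: real_integrable_def less_top)
    then show ?thesis
      using nn_integral_add_measure[OF _ sets, of "\<lambda>x. ennreal (g x)"] g(1) by (simp add: enn2real_plus)
  qed
  note this[of f] this[of "\<lambda>x. - f x"]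
  moreover have "integrable (add_measure M N) f"
    using f integrable_add_measure[OF sets] by simp
  ultimately show ?thesis
    using f by (simp add: real_lebesgue_integral_def)
qed

lemma finite_measure_add_measure:
  assumes "finite_measure M" "finite_measure N" and sets: "sets N = sets M"
  shows "finite_measure (add_measure M N)"
proof
  show "emeasure (add_measure M N) (space (add_measure M N)) \<noteq> \<infinity>"
    using assms(1,2)[THEN finite_measure.emeasure_finite] by (simp add: emeasure_add_measure[OF sets])
qed

lemma measure_add_measure:
  assumes "finite_measure M" "finite_measure N" and "sets N = sets M" and "A \<in> sets M"
  shows "measure (add_measure M N) A = measure M A + measure N A"
  using assms emeasure_add_measure[of N M A]
  by (simp add: finite_measure.emeasure_eq_measure finite_measure_add_measure
      flip: ennreal_plus)

lemma total_variation_eq: "total_variation X \<mu> = add_measure (positive_variation X \<mu>) (negative_variation X \<mu>)"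
  unfolding total_variation_def add_measure_def by simp

lemma sets_total_variation [simp, measurable_cong]: "sets (total_variation X \<mu>) = sets X"
  unfolding total_variation_eq by simp

lemma space_total_variation [simp]: "space (total_variation X \<mu>) = space X"
  unfolding total_variation_eq by simp

lemma finite_total_variation:
  "\<mu> \<in> finite_signed_measures X \<Longrightarrow> finite_measure (total_variation X \<mu>)"
  unfolding total_variation_eq
  by (intro finite_measure_add_measure finite_positive_variation finite_negative_variation) simp_all

lemma integrable_total_variation:
  fixes g :: "'a \<Rightarrow> real"
  shows "integrable (total_variation X \<mu>) g \<longleftrightarrow>
    integrable (positive_variation X \<mu>) g \<and> integrable (negative_variation X \<mu>) g"
  unfolding total_variation_eq by (intro integrable_add_measure) simp

lemma integrable_bounded:
  fixes g :: "'a \<Rightarrow> real"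
  assumes "finite_measure M" "sets M = sets X" "g \<in> borel_measurable X"
    and "\<And>y. y \<in> space X \<Longrightarrow> \<bar>g y\<bar> \<le> B"
  shows "integrable M g"
  using assms sets_eq_imp_space_eq[OF assms(2)]
  by (intro finite_measure.integrable_const_bound[where B = B])
    (auto simp: measurable_cong_sets[OF assms(2) refl])

lemma signed_integral_add:
  assumes "integrable (total_variation X \<mu>) f" "integrable (total_variation X \<mu>) g"
  shows "signed_integral X \<mu> (\<lambda>y. f y + g y) = signed_integral X \<mu> f + signed_integral X \<mu> g"
  using assms unfolding signed_integral_def integrable_total_variation by simp

lemma signed_integral_diff:
  assumes "integrable (total_variation X \<mu>) f" "integrable (total_variation X \<mu>) g"
  shows "signed_integral X \<mu> (\<lambda>y. f y - g y) = signed_integral X \<mu> f - signed_integral X \<mu> g"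
  using assms unfolding signed_integral_def integrable_total_variation by simp

lemma signed_integral_scale: "signed_integral X \<mu> (\<lambda>y. c * f y) = c * signed_integral X \<mu> f"
  unfolding signed_integral_def by (simp add: right_diff_distrib)

lemma signed_integral_cong:
  "(\<And>y. y \<in> space X \<Longrightarrow> f y = g y) \<Longrightarrow> signed_integral X \<mu> f = signed_integral X \<mu> g"
  unfolding signed_integral_def by (intro arg_cong2[where f = "(-)"] Bochner_Integration.integral_cong) auto

lemma abs_signed_integral_le:
  assumes g: "integrable (total_variation X \<mu>) g"
  shows "\<bar>signed_integral X \<mu> g\<bar> \<le> (\<integral>y. \<bar>g y\<bar> \<partial>total_variation X \<mu>)"
proof -
  have pn: "integrable (positive_variation X \<mu>) g" "integrable (negative_variation X \<mu>) g"
    using g unfolding integrable_total_variation by auto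
  have "\<bar>signed_integral X \<mu> g\<bar> \<le> \<bar>\<integral>y. g y \<partial>positive_variation X \<mu>\<bar> + \<bar>\<integral>y. g y \<partial>negative_variation X \<mu>\<bar>"
    unfolding signed_integral_def by linarith
  also have "\<dots> \<le> (\<integral>y. \<bar>g y\<bar> \<partial>positive_variation X \<mu>) + (\<integral>y. \<bar>g y\<bar> \<partial>negative_variation X \<mu>)"
    by (intro add_mono integral_abs_bound)
  also have "\<dots> = (\<integral>y. \<bar>g y\<bar> \<partial>total_variation X \<mu>)"
    unfolding total_variation_eq using pn by (intro integral_add_measure[symmetric]) auto
  finally show ?thesis .
qed

lemma abs_signed_integral_le_total_variation_norm:
  assumes \<mu>: "\<mu> \<in> finite_signed_measures X" and g: "g \<in> borel_measurable X"
    and B: "\<And>y. y \<in> space X \<Longrightarrow> \<bar>g y\<bar> \<le> B"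
  shows "\<bar>signed_integral X \<mu> g\<bar> \<le> B * total_variation_norm X \<mu>"
proof -
  interpret finite_measure "total_variation X \<mu>"
    by (rule finite_total_variation[OF \<mu>])
  have int: "integrable (total_variation X \<mu>) g"
    using finite_total_variation[OF \<mu>] sets_total_variation g B by (rule integrable_bounded)
  have "(\<integral>y. \<bar>g y\<bar> \<partial>total_variation X \<mu>) \<le> (\<integral>y. B \<partial>total_variation X \<mu>)"
    using int B by (intro integral_mono) auto
  also have "\<dots> = B * total_variation_norm X \<mu>"
    unfolding total_variation_norm_def by simp
  finally show ?thesis
    using abs_signed_integral_le[OF int] by linarith
qed

text \<open>
  Any decomposition into finite measures computes the signed integral. It suffices to find one for
  sums and multiples of signed measures, where the Jordan decomposition itself is not additive.
\<close>

lemma signed_integral_eq_diff: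
  assumes \<mu>: "\<mu> \<in> finite_signed_measures X"
    and P: "finite_measure P" "sets P = sets X" and Q: "finite_measure Q" "sets Q = sets X"
    and diff: "\<And>A. A \<in> sets X \<Longrightarrow> \<mu> A = measure P A - measure Q A"
    and g: "g \<in> borel_measurable X" and B: "\<And>y. y \<in> space X \<Longrightarrow> \<bar>g y\<bar> \<le> B"
  shows "signed_integral X \<mu> g = (\<integral>y. g y \<partial>P) - (\<integral>y. g y \<partial>Q)"
proof -
  let ?p = "positive_variation X \<mu>" and ?n = "negative_variation X \<mu>"
  note fin = finite_positive_variation[OF \<mu>] finite_negative_variation[OF \<mu>]
  have int: "integrable P g" "integrable Q g" "integrable ?p g" "integrable ?n g"
    using P Q fin by (auto intro: integrable_bounded[OF _ _ g B])
  have "add_measure P ?n = add_measure ?p Q"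
  proof (rule measure_eqI)
    fix A assume "A \<in> sets (add_measure P ?n)"
    then have A: "A \<in> sets X"
      using P by simp
    have "measure P A + measure ?n A = measure ?p A + measure Q A"
      using diff[OF A] jordan_decomposition[OF \<mu> A] by simp
    then have "measure (add_measure P ?n) A = measure (add_measure ?p Q) A"
      using P Q fin A by (simp add: measure_add_measure)
    then show "emeasure (add_measure P ?n) A = emeasure (add_measure ?p Q) A"
      using P Q fin by (simp add: finite_measure.emeasure_eq_measure finite_measure_add_measure)
  qed (use P in simp)
  then have "(\<integral>y. g y \<partial>P) + (\<integral>y. g y \<partial>?n) = (\<integral>y. g y \<partial>?p) + (\<integral>y. g y \<partial>Q)"
    using P Q int by (simp flip: integral_add_measure)
  then show ?thesis
    unfolding signed_integral_def by linarith
qed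

lemma signed_integral_add_measure:
  assumes \<mu>: "\<mu> \<in> finite_signed_measures X" and \<nu>: "\<nu> \<in> finite_signed_measures X"
    and sum: "(\<lambda>A. \<mu> A + \<nu> A) \<in> finite_signed_measures X"
    and g: "g \<in> borel_measurable X" and B: "\<And>y. y \<in> space X \<Longrightarrow> \<bar>g y\<bar> \<le> B"
  shows "signed_integral X (\<lambda>A. \<mu> A + \<nu> A) g = signed_integral X \<mu> g + signed_integral X \<nu> g"
proof -
  let ?p = "positive_variation X" and ?n = "negative_variation X"
  note fin = finite_positive_variation[OF \<mu>] finite_negative_variation[OF \<mu>]
    finite_positive_variation[OF \<nu>] finite_negative_variation[OF \<nu>]
  have int: "integrable (?p \<mu>) g" "integrable (?n \<mu>) g" "integrable (?p \<nu>) g" "integrable (?n \<nu>) g"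
    using fin by (auto intro: integrable_bounded[OF _ _ g B])
  have "signed_integral X (\<lambda>A. \<mu> A + \<nu> A) g =
      (\<integral>y. g y \<partial>add_measure (?p \<mu>) (?p \<nu>)) - (\<integral>y. g y \<partial>add_measure (?n \<mu>) (?n \<nu>))"
  proof (rule signed_integral_eq_diff[OF sum _ _ _ _ _ g B])
    fix A assume A: "A \<in> sets X"
    show "\<mu> A + \<nu> A = measure (add_measure (?p \<mu>) (?p \<nu>)) A - measure (add_measure (?n \<mu>) (?n \<nu>)) A"
      using fin A jordan_decomposition[OF \<mu> A] jordan_decomposition[OF \<nu> A]
      by (simp add: measure_add_measure)
  qed (use fin in \<open>auto intro: finite_measure_add_measure\<close>)
  also have "\<dots> = signed_integral X \<mu> g + signed_integral X \<nu> g"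
    unfolding signed_integral_def using int by (simp add: integral_add_measure)
  finally show ?thesis .
qed

lemma signed_integral_scale_measure:
  assumes \<mu>: "\<mu> \<in> finite_signed_measures X"
    and g: "g \<in> borel_measurable X" and B: "\<And>y. y \<in> space X \<Longrightarrow> \<bar>g y\<bar> \<le> B"
  shows "signed_integral X (\<lambda>A. c * \<mu> A) g = c * signed_integral X \<mu> g"
proof -
  define scaled where "scaled M = density M (\<lambda>_. ennreal \<bar>c\<bar>)" for M :: "'a measure"
  have scaled: "finite_measure (scaled M)" "sets (scaled M) = sets X"
      "(\<integral>y. g y \<partial>scaled M) = \<bar>c\<bar> * (\<integral>y. g y \<partial>M)"
      "A \<in> sets X \<Longrightarrow> measure (scaled M) A = \<bar>c\<bar> * measure M A"
    if M: "finite_measure M" "sets M = sets X" for M A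
  proof -
    have gM: "g \<in> borel_measurable M"
      using g by (simp add: measurable_cong_sets[OF M(2) refl])
    show "sets (scaled M) = sets X"
      unfolding scaled_def using M by simp
    show "(\<integral>y. g y \<partial>scaled M) = \<bar>c\<bar> * (\<integral>y. g y \<partial>M)"
      unfolding scaled_def using gM by (subst integral_real_density) auto
    have e: "emeasure (scaled M) A = ennreal \<bar>c\<bar> * emeasure M A" if "A \<in> sets M" for A
      unfolding scaled_def using that by (simp add: emeasure_density nn_integral_cmult_indicator)
    then show "finite_measure (scaled M)"
      using finite_measure.emeasure_finite[OF M(1), of "space M"]
      by (intro finite_measureI) (simp add: scaled_def ennreal_mult_eq_top_iff)
    show "measure (scaled M) A = \<bar>c\<bar> * measure M A" if "A \<in> sets X"
      using e[of A] that M unfolding measure_def by (simp add: enn2real_mult)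
  qed
  note fin = finite_positive_variation[OF \<mu>] finite_negative_variation[OF \<mu>]
  note c\<mu> = finite_signed_measures_scale[OF \<mu>, of c]
  let ?p = "positive_variation X \<mu>" and ?n = "negative_variation X \<mu>"
  show ?thesis
  proof (cases "0 \<le> c")
    case True
    have "signed_integral X (\<lambda>A. c * \<mu> A) g = (\<integral>y. g y \<partial>scaled ?p) - (\<integral>y. g y \<partial>scaled ?n)"
      using fin True jordan_decomposition[OF \<mu>]
      by (intro signed_integral_eq_diff[OF c\<mu> _ _ _ _ _ g B]) (auto simp: scaled right_diff_distrib)
    then show ?thesis
      using fin True unfolding signed_integral_def by (simp add: scaled right_diff_distrib)
  next
    case False
    have "signed_integral X (\<lambda>A. c * \<mu> A) g = (\<integral>y. g y \<partial>scaled ?n) - (\<integral>y. g y \<partial>scaled ?p)"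
      using fin False jordan_decomposition[OF \<mu>]
      by (intro signed_integral_eq_diff[OF c\<mu> _ _ _ _ _ g B]) (auto simp: scaled right_diff_distrib)
    then show ?thesis
      using fin False unfolding signed_integral_def by (simp add: scaled right_diff_distrib)
  qed
qed

lemma positive_variation_scale_le:
  assumes \<mu>: "\<mu> \<in> finite_signed_measures X" and c: "0 < c" and A: "A \<in> sets X"
  shows "measure (positive_variation X (\<lambda>A. c * \<mu> A)) A \<le> c * measure (positive_variation X \<mu>) A"
  using c by (intro positive_variation_least finite_signed_measures_scale \<mu> A mult_left_mono
      positive_variation_upper) auto

lemma positive_variation_scale:
  assumes \<mu>: "\<mu> \<in> finite_signed_measures X" and c: "0 < c" and A: "A \<in> sets X"
  shows "measure (positive_variation X (\<lambda>A. c * \<mu> A)) A = c * measure (positive_variation X \<mu>) A"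
proof (rule antisym)
  have "measure (positive_variation X (\<lambda>A. 1 / c * (c * \<mu> A))) A
      \<le> 1 / c * measure (positive_variation X (\<lambda>A. c * \<mu> A)) A"
    using c by (intro positive_variation_scale_le finite_signed_measures_scale \<mu> A) simp
  then show "c * measure (positive_variation X \<mu>) A \<le> measure (positive_variation X (\<lambda>A. c * \<mu> A)) A"
    using c by (simp add: field_simps)
qed (rule positive_variation_scale_le[OF assms])

lemma total_variation_norm_eq:
  assumes \<mu>: "\<mu> \<in> finite_signed_measures X"
  shows "total_variation_norm X \<mu> =
    measure (positive_variation X \<mu>) (space X) + measure (negative_variation X \<mu>) (space X)"
  unfolding total_variation_norm_def total_variation_eq
  using finite_positive_variation[OF \<mu>] finite_negative_variation[OF \<mu>] by (intro measure_add_measure) auto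

lemma total_variation_norm_scale:
  assumes \<mu>: "\<mu> \<in> finite_signed_measures X" and c: "0 < c"
  shows "total_variation_norm X (\<lambda>A. c * \<mu> A) = c * total_variation_norm X \<mu>"
proof -
  have "measure (negative_variation X (\<lambda>A. c * \<mu> A)) (space X) = c * measure (negative_variation X \<mu>) (space X)"
    unfolding negative_variation_def
    using positive_variation_scale[OF finite_signed_measures_minus[OF \<mu>] c sets.top] by simp
  then show ?thesis
    unfolding total_variation_norm_eq[OF \<mu>] total_variation_norm_eq[OF finite_signed_measures_scale[OF \<mu>]]
    using positive_variation_scale[OF \<mu> c sets.top] by (simp add: distrib_left)
qed

section \<open>Integration against signed measures on reproducing kernel Hilbert spaces\<close>

text \<open>
  Integrability of all \<open>h \<in> H\<close> implies boundedness of \<open>h \<mapsto> \<integral> \<bar>h\<bar> d\<nu>\<close>. On \<open>A n = {x. k x x \<le> n}\<close> the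
  functions of the unit ball are bounded by \<open>\<surd>n\<close>, so the integrals over \<open>A n\<close> are bounded seminorms;
  they increase to the full integral, and uniform boundedness applies.
\<close>

lemma (in rkhs_functions) integral_abs_le_norm:
  assumes \<nu>: "finite_measure \<nu>" and X: "space \<nu> = X"
    and diag: "(\<lambda>x. k x x) \<in> borel_measurable \<nu>"
    and int: "\<And>h. h \<in> H \<Longrightarrow> integrable \<nu> h"
  obtains C where "\<And>h. h \<in> H \<Longrightarrow> (\<integral>x. \<bar>h x\<bar> \<partial>\<nu>) \<le> C * N h"
proof -
  interpret finite_measure \<nu> by (rule \<nu>)
  define A where "A n = {x \<in> space \<nu>. k x x \<le> real n}" for n :: nat
  have A: "A n \<in> sets \<nu>" for n
    unfolding A_def using diag by measurable
  define p where "p n h = (\<integral>x. indicator (A n) x * \<bar>h x\<bar> \<partial>\<nu>)" for n and h :: "'a \<Rightarrow> real"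
  have int_p: "integrable \<nu> (\<lambda>x. indicator (A n) x * \<bar>h x\<bar>)" if "h \<in> H" for n h
    using integrable_mult_indicator[OF A integrable_abs[OF int[OF that]]] by simp
  have eval: "\<bar>h x\<bar> \<le> sqrt (real n) * N h" if h: "h \<in> H" and x: "x \<in> A n" for h n x
  proof -
    have xX: "x \<in> X" and "k x x \<le> real n"
      using x X unfolding A_def by auto
    then have "N (kernel_section x) \<le> sqrt (real n)"
      using norm_kernel_section_square[OF xX] by (simp add: real_le_rsqrt)
    then show ?thesis
      using abs_eval_le[OF xX h] mult_right_mono[OF _ norm_nonneg[OF h]] by (meson order_trans)
  qed
  obtain C where C: "\<And>n h. n \<in> UNIV \<Longrightarrow> h \<in> H \<Longrightarrow> p n h \<le> C * N h"
  proof (rule uniform_boundedness[of UNIV p])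
    fix n and f g :: "'a \<Rightarrow> real" assume f: "f \<in> H" and g: "g \<in> H"
    have "p n (\<lambda>x. f x + g x) \<le> (\<integral>x. indicator (A n) x * \<bar>f x\<bar> + indicator (A n) x * \<bar>g x\<bar> \<partial>\<nu>)"
      unfolding p_def using int_p f g add_mem[OF f g]
      by (intro integral_mono Bochner_Integration.integrable_add) (auto simp: indicator_def)
    then show "p n (\<lambda>x. f x + g x) \<le> p n f + p n g"
      unfolding p_def using int_p f g by simp
  next
    fix n c and f :: "'a \<Rightarrow> real"
    show "p n (\<lambda>x. c * f x) = \<bar>c\<bar> * p n f"
      unfolding p_def by (simp add: abs_mult mult.left_commute)
  next
    fix n
    have "p n h \<le> sqrt (real n) * measure \<nu> (space \<nu>) * N h" if h: "h \<in> H" for h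
    proof -
      have "p n h \<le> (\<integral>x. sqrt (real n) * N h \<partial>\<nu>)"
        unfolding p_def using int_p[OF h] eval[OF h] norm_nonneg[OF h]
        by (intro integral_mono) (auto simp: indicator_def)
      then show ?thesis
        by (simp add: ac_simps)
    qed
    then show "\<exists>C. \<forall>h\<in>H. p n h \<le> C * N h"
      by blast
  next
    fix h assume h: "h \<in> H"
    have "p n h \<le> (\<integral>x. \<bar>h x\<bar> \<partial>\<nu>)" for n
      unfolding p_def using int_p[OF h] int[OF h] by (intro integral_mono) (auto simp: indicator_def)
    then show "\<exists>B. \<forall>n\<in>UNIV. p n h \<le> B"
      by blast
  next
    fix C assume "\<And>n h. n \<in> UNIV \<Longrightarrow> h \<in> H \<Longrightarrow> p n h \<le> C * N h"
    then show thesis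
      by (rule that)
  qed
  show ?thesis
  proof (rule that)
    fix h assume h: "h \<in> H"
    have "(\<lambda>n. p n h) \<longlonglongrightarrow> (\<integral>x. \<bar>h x\<bar> \<partial>\<nu>)"
      unfolding p_def
    proof (rule integral_dominated_convergence[where w = "\<lambda>x. \<bar>h x\<bar>"])
      show "AE x in \<nu>. (\<lambda>n. indicator (A n) x * \<bar>h x\<bar>) \<longlonglongrightarrow> \<bar>h x\<bar>"
      proof (rule AE_I2)
        fix x assume x: "x \<in> space \<nu>"
        obtain n0 :: nat where n0: "k x x \<le> real n0"
          using real_arch_simple by blast
        have "indicator (A n) x * \<bar>h x\<bar> = \<bar>h x\<bar>" if "n0 \<le> n" for n
          using x n0 that unfolding A_def by simp
        then have "\<forall>\<^sub>F n in sequentially. indicator (A n) x * \<bar>h x\<bar> = \<bar>h x\<bar>"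
          unfolding eventually_sequentially by blast
        then show "(\<lambda>n. indicator (A n) x * \<bar>h x\<bar>) \<longlonglongrightarrow> \<bar>h x\<bar>"
          by (rule tendsto_eventually)
      qed
    qed (use int[OF h] int_p[OF h] in \<open>auto simp: indicator_def\<close>)
    then show "(\<integral>x. \<bar>h x\<bar> \<partial>\<nu>) \<le> C * N h"
      by (rule LIMSEQ_le_const2) (use C[OF UNIV_I h] in auto)
  qed
qed

text \<open>
  Integration against \<open>\<mu>\<close> is a bounded functional on \<open>H\<close>; the values of its representing vector are its
  values at the kernel sections.
\<close>

theorem (in rkhs_functions) kernel_mean_mem:
  assumes X: "space M = X" and \<mu>: "\<mu> \<in> finite_signed_measures M"
    and diag: "(\<lambda>x. k x x) \<in> borel_measurable M"
    and int: "\<And>h. h \<in> H \<Longrightarrow> integrable (total_variation M \<mu>) h"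
  shows "(\<lambda>x. if x \<in> X then signed_integral M \<mu> (k x) else 0) \<in> H"
proof -
  have diag': "(\<lambda>x. k x x) \<in> borel_measurable (total_variation M \<mu>)"
    using diag by (simp add: measurable_cong_sets[OF sets_total_variation refl])
  obtain C where C: "\<And>h. h \<in> H \<Longrightarrow> (\<integral>x. \<bar>h x\<bar> \<partial>total_variation M \<mu>) \<le> C * N h"
    using integral_abs_le_norm[OF finite_total_variation[OF \<mu>] _ diag' int] X by auto
  obtain g where g: "g \<in> H" "\<And>h. h \<in> H \<Longrightarrow> ip h g = signed_integral M \<mu> h"
  proof (rule riesz[of "signed_integral M \<mu>" C])
    show "signed_integral M \<mu> h \<le> C * N h" if "h \<in> H" for h
      using abs_signed_integral_le[OF int[OF that]] C[OF that] by linarith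
  qed (simp_all add: signed_integral_add int signed_integral_scale)
  have "g x = (if x \<in> X then signed_integral M \<mu> (k x) else 0)" for x
  proof (cases "x \<in> X")
    case True
    have "g x = ip (kernel_section x) g"
      using reproducing[OF True g(1)] ip_commute[OF g(1) kernel_section_mem[OF True]] by simp
    also have "\<dots> = signed_integral M \<mu> (kernel_section x)"
      by (rule g(2)[OF kernel_section_mem[OF True]])
    also have "\<dots> = signed_integral M \<mu> (k x)"
      using X by (intro signed_integral_cong) simp
    finally show ?thesis
      using True by simp
  next
    case False
    then show ?thesis
      using outside[OF g(1)] by simp
  qed
  then have "(\<lambda>x. if x \<in> X then signed_integral M \<mu> (k x) else 0) = g"
    by auto
  with g(1) show ?thesis
    by simp
qed

section \<open>Integral reproducing kernel Banach spaces\<close>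

lemma pointwise_bounded_operator_integral_function:
  assumes "space X \<noteq> {}" and MM: "banach_space_of_signed_measures X MM NM"
    and emb: "continuously_embedded MM NM (finite_signed_measures X) (total_variation_norm X)"
    and meas: "\<And>x. x \<in> space X \<Longrightarrow> \<Psi> x \<in> borel_measurable X"
    and B: "\<And>x. x \<in> space X \<Longrightarrow> \<exists>B. \<forall>y\<in>space X. \<bar>\<Psi> x y\<bar> \<le> B"
  shows "pointwise_bounded_operator (sets X) MM NM (space X) (integral_function X \<Psi>)"
proof -
  have sub: "MM \<subseteq> finite_signed_measures X" and "banach_function_space (sets X) MM NM"
    using MM unfolding banach_space_of_signed_measures_def by auto
  then interpret MM: banach_functions "sets X" MM NM
    by unfold_locales
  have cont: "\<exists>d>0. \<forall>\<mu>\<in>MM. NM \<mu> < d \<longrightarrow> total_variation_norm X \<mu> < 1"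
  proof -
    have "\<exists>d>0. \<forall>\<mu>\<in>MM. ndist NM \<mu> (\<lambda>A. 0) < d \<longrightarrow> ndist (total_variation_norm X) \<mu> (\<lambda>A. 0) < 1"
      using emb MM.zero_mem zero_less_one unfolding continuously_embedded_def by blast
    then show ?thesis
      unfolding ndist_def by simp
  qed
  obtain C where C: "\<And>\<mu>. \<mu> \<in> MM \<Longrightarrow> total_variation_norm X \<mu> \<le> C * NM \<mu>"
  proof (rule MM.bounded_if_continuous_at_zero[of "total_variation_norm X", OF _ cont])
    show "total_variation_norm X (\<lambda>A. c * \<mu> A) = c * total_variation_norm X \<mu>" if "0 < c" "\<mu> \<in> MM" for c \<mu>
      using that sub by (intro total_variation_norm_scale) auto
  next
    fix C assume "\<And>\<mu>. \<mu> \<in> MM \<Longrightarrow> total_variation_norm X \<mu> \<le> C * NM \<mu>"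
    then show thesis
      by (rule that)
  qed
  show ?thesis
  proof
    fix \<mu> \<nu> assume \<mu>\<nu>: "\<mu> \<in> MM" "\<nu> \<in> MM"
    then have "signed_integral X (\<lambda>A. \<mu> A + \<nu> A) (\<Psi> x) = signed_integral X \<mu> (\<Psi> x) + signed_integral X \<nu> (\<Psi> x)"
      if x: "x \<in> space X" for x
    proof -
      obtain b where "\<And>y. y \<in> space X \<Longrightarrow> \<bar>\<Psi> x y\<bar> \<le> b"
        using B[OF x] by blast
      then show ?thesis
        using \<mu>\<nu> sub MM.add_mem[OF \<mu>\<nu>] meas[OF x] by (intro signed_integral_add_measure) auto
    qed
    then show "integral_function X \<Psi> (\<lambda>A. \<mu> A + \<nu> A) =
        (\<lambda>x. integral_function X \<Psi> \<mu> x + integral_function X \<Psi> \<nu> x)"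
      unfolding integral_function_def by auto
  next
    fix \<mu> c assume \<mu>: "\<mu> \<in> MM"
    have "signed_integral X (\<lambda>A. c * \<mu> A) (\<Psi> x) = c * signed_integral X \<mu> (\<Psi> x)" if x: "x \<in> space X" for x
    proof -
      obtain b where "\<And>y. y \<in> space X \<Longrightarrow> \<bar>\<Psi> x y\<bar> \<le> b"
        using B[OF x] by blast
      then show ?thesis
        using \<mu> sub meas[OF x] by (intro signed_integral_scale_measure) auto
    qed
    then show "integral_function X \<Psi> (\<lambda>A. c * \<mu> A) = (\<lambda>x. c * integral_function X \<Psi> \<mu> x)"
      unfolding integral_function_def by auto
  next
    fix x assume x: "x \<in> space X"
    obtain b where b: "\<And>y. y \<in> space X \<Longrightarrow> \<bar>\<Psi> x y\<bar> \<le> b"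
      using B[OF x] by blast
    have "0 \<le> b"
      using b[OF x] by linarith
    have "\<bar>integral_function X \<Psi> \<mu> x\<bar> \<le> b * C * NM \<mu>" if \<mu>: "\<mu> \<in> MM" for \<mu>
    proof -
      have "\<bar>signed_integral X \<mu> (\<Psi> x)\<bar> \<le> b * total_variation_norm X \<mu>"
        using \<mu> sub meas[OF x] b by (intro abs_signed_integral_le_total_variation_norm) auto
      also have "\<dots> \<le> b * (C * NM \<mu>)"
        using C[OF \<mu>] \<open>0 \<le> b\<close> by (rule mult_left_mono)
      finally show ?thesis
        unfolding integral_function_def using x by (simp add: mult.assoc)
    qed
    then show "\<exists>C. \<forall>\<mu>\<in>MM. \<bar>integral_function X \<Psi> \<mu> x\<bar> \<le> C * NM \<mu>"
      by blast
  qed (use assms(1) in \<open>auto simp: integral_function_def\<close>)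
qed

theorem proper_bsf_integral_rkbs:
  assumes "space X \<noteq> {}" and "banach_space_of_signed_measures X MM NM"
    and "continuously_embedded MM NM (finite_signed_measures X) (total_variation_norm X)"
    and "\<And>x. x \<in> space X \<Longrightarrow> \<Psi> x \<in> borel_measurable X"
    and "\<And>x. x \<in> space X \<Longrightarrow> \<exists>B. \<forall>y\<in>space X. \<bar>\<Psi> x y\<bar> \<le> B"
  shows "proper_bsf (space X) (integral_rkbs X MM \<Psi>) (integral_rkbs_norm X MM NM \<Psi>)"
proof -
  interpret pointwise_bounded_operator "sets X" MM NM "space X" "integral_function X \<Psi>"
    by (rule pointwise_bounded_operator_integral_function[OF assms])
  have "integral_rkbs X MM \<Psi> = integral_function X \<Psi> ` MM"
    unfolding integral_rkbs_def by blast
  moreover have "integral_rkbs_norm X MM NM \<Psi> = quotient_norm"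
    unfolding integral_rkbs_norm_def quotient_norm_def ..
  ultimately show ?thesis
    using proper_bsf_image by simp
qed

text \<open>
  The integral of the difference splits only under integrability of both kernel sections; the kernels
  themselves may be unbounded.
\<close>

lemma integral_function_diff_mem_sum:
  assumes H1: "rkhs_of_kernel (space X) k1 H1 N1" and H2: "rkhs_of_kernel (space X) k2 H2 N2"
    and \<mu>: "\<mu> \<in> finite_signed_measures X"
    and diag: "(\<lambda>x. k1 x x) \<in> borel_measurable X" "(\<lambda>x. k2 x x) \<in> borel_measurable X"
    and L1: "H1 \<subseteq> L1_functions X \<mu>" "H2 \<subseteq> L1_functions X \<mu>"
  shows "integral_function X (\<lambda>x y. k1 x y - k2 x y) \<mu> \<in> function_set_sum H1 H2"
proof -
  obtain ip1 where "rkhs_functions (space X) H1 N1 ip1 k1"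
    using rkhs_functions_if_rkhs_of_kernel[OF H1] .
  then interpret H1: rkhs_functions "space X" H1 N1 ip1 k1 .
  obtain ip2 where "rkhs_functions (space X) H2 N2 ip2 k2"
    using rkhs_functions_if_rkhs_of_kernel[OF H2] .
  then interpret H2: rkhs_functions "space X" H2 N2 ip2 k2 .
  have int: "h \<in> H1 \<Longrightarrow> integrable (total_variation X \<mu>) h" "h \<in> H2 \<Longrightarrow> integrable (total_variation X \<mu>) h" for h
    using L1 unfolding L1_functions_def by auto
  define g1 where "g1 = (\<lambda>x. if x \<in> space X then signed_integral X \<mu> (k1 x) else 0)"
  define g2 where "g2 = (\<lambda>x. if x \<in> space X then signed_integral X \<mu> (k2 x) else 0)"
  have g: "g1 \<in> H1" "g2 \<in> H2"
    unfolding g1_def g2_def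
    using H1.kernel_mean_mem[OF refl \<mu> diag(1) int(1)] H2.kernel_mean_mem[OF refl \<mu> diag(2) int(2)] by auto
  have "signed_integral X \<mu> (\<lambda>y. k1 x y - k2 x y) = signed_integral X \<mu> (k1 x) - signed_integral X \<mu> (k2 x)"
    if x: "x \<in> space X" for x
  proof -
    have "signed_integral X \<mu> (\<lambda>y. k1 x y - k2 x y) =
        signed_integral X \<mu> (\<lambda>y. H1.kernel_section x y - H2.kernel_section x y)"
      by (intro signed_integral_cong) simp
    also have "\<dots> = signed_integral X \<mu> (H1.kernel_section x) - signed_integral X \<mu> (H2.kernel_section x)"
      by (intro signed_integral_diff int H1.kernel_section_mem H2.kernel_section_mem x)
    also have "signed_integral X \<mu> (H1.kernel_section x) = signed_integral X \<mu> (k1 x)"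
      by (intro signed_integral_cong) simp
    also have "signed_integral X \<mu> (H2.kernel_section x) = signed_integral X \<mu> (k2 x)"
      by (intro signed_integral_cong) simp
    finally show ?thesis .
  qed
  then have "integral_function X (\<lambda>x y. k1 x y - k2 x y) \<mu> = (\<lambda>x. g1 x + - g2 x)"
    unfolding integral_function_def g1_def g2_def by auto
  then show ?thesis
    unfolding function_set_sum_def using g(1) H2.minus_mem[OF g(2)]
    by (intro CollectI exI[of _ g1] exI[of _ "\<lambda>x. - g2 x"]) simp
qed

section \<open>Embedding into the reproducing kernel Hilbert space of the sum\<close>

theorem lemma18:
  fixes X :: "'a measure"
    and MM :: "('a set \<Rightarrow> real) set" and NM :: "('a set \<Rightarrow> real) \<Rightarrow> real"
    and k1 k2 :: "'a \<Rightarrow> 'a \<Rightarrow> real"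
    and H1 H2 :: "('a \<Rightarrow> real) set" and N1 N2 :: "('a \<Rightarrow> real) \<Rightarrow> real"
  assumes "space X \<noteq> {}"
    and "banach_space_of_signed_measures X MM NM"
    and "continuously_embedded MM NM (finite_signed_measures X) (total_variation_norm X)"
    and "measurable_kernel X k1" and "measurable_kernel X k2"
    and "rkhs_of_kernel (space X) k1 H1 N1" and "rkhs_of_kernel (space X) k2 H2 N2"
    and "\<exists>B. \<forall>x\<in>space X. \<forall>y\<in>space X. \<bar>k1 x y - k2 x y\<bar> \<le> B"
  shows "proper_bsf (space X) (integral_rkbs X MM (\<lambda>x y. k1 x y - k2 x y))
           (integral_rkbs_norm X MM NM (\<lambda>x y. k1 x y - k2 x y)) \<and>
         ((\<forall>\<mu>\<in>MM. H1 \<subseteq> L1_functions X \<mu> \<and> H2 \<subseteq> L1_functions X \<mu>) \<longrightarrow>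
            (\<exists>N. rkhs_of_kernel (space X) (\<lambda>x y. k1 x y + k2 x y) (function_set_sum H1 H2) N) \<and>
            (\<forall>H N. rkhs_of_kernel (space X) (\<lambda>x y. k1 x y + k2 x y) H N \<longrightarrow>
               H = function_set_sum H1 H2 \<and>
               continuously_embedded (integral_rkbs X MM (\<lambda>x y. k1 x y - k2 x y))
                 (integral_rkbs_norm X MM NM (\<lambda>x y. k1 x y - k2 x y)) H N))"
proof (intro conjI impI allI)
  have k: "(\<lambda>(x, y). k1 x y) \<in> borel_measurable (X \<Otimes>\<^sub>M X)" "(\<lambda>(x, y). k2 x y) \<in> borel_measurable (X \<Otimes>\<^sub>M X)"
    using assms(4,5) unfolding measurable_kernel_def by auto
  have section_meas: "k1 x \<in> borel_measurable X" "k2 x \<in> borel_measurable X" if "x \<in> space X" for x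
    using measurable_compose[OF measurable_Pair1'[OF that] k(1)] measurable_compose[OF measurable_Pair1'[OF that] k(2)]
    by simp_all
  have "(\<lambda>x. (x, x)) \<in> X \<rightarrow>\<^sub>M X \<Otimes>\<^sub>M X"
    by (intro measurable_Pair measurable_ident_sets refl)
  from measurable_compose[OF this k(1)] measurable_compose[OF this k(2)]
  have diag: "(\<lambda>x. k1 x x) \<in> borel_measurable X" "(\<lambda>x. k2 x x) \<in> borel_measurable X"
    by simp_all
  show E: "proper_bsf (space X) (integral_rkbs X MM (\<lambda>x y. k1 x y - k2 x y))
           (integral_rkbs_norm X MM NM (\<lambda>x y. k1 x y - k2 x y))"
  proof (rule proper_bsf_integral_rkbs[OF assms(1-3)])
    fix x assume x: "x \<in> space X"
    show "(\<lambda>y. k1 x y - k2 x y) \<in> borel_measurable X"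
      using section_meas[OF x] by (rule borel_measurable_diff)
    show "\<exists>B. \<forall>y\<in>space X. \<bar>k1 x y - k2 x y\<bar> \<le> B"
      using assms(8) x by blast
  qed
  show sum: "\<exists>N. rkhs_of_kernel (space X) (\<lambda>x y. k1 x y + k2 x y) (function_set_sum H1 H2) N"
    by (rule rkhs_of_sum_of_kernels[OF assms(6,7)])
  fix H N assume L1: "\<forall>\<mu>\<in>MM. H1 \<subseteq> L1_functions X \<mu> \<and> H2 \<subseteq> L1_functions X \<mu>"
    and H: "rkhs_of_kernel (space X) (\<lambda>x y. k1 x y + k2 x y) H N"
  show eq: "H = function_set_sum H1 H2"
    using sum rkhs_kernel_determines[OF H] by blast
  have "MM \<subseteq> finite_signed_measures X"
    using assms(2) unfolding banach_space_of_signed_measures_def by simp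
  then have "integral_rkbs X MM (\<lambda>x y. k1 x y - k2 x y) \<subseteq> H"
    unfolding integral_rkbs_def eq
    using integral_function_diff_mem_sum[OF assms(6,7) _ diag] L1 by blast
  moreover obtain ip where "rkhs_functions (space X) H N ip (\<lambda>x y. k1 x y + k2 x y)"
    using rkhs_functions_if_rkhs_of_kernel[OF H] .
  ultimately show "continuously_embedded (integral_rkbs X MM (\<lambda>x y. k1 x y - k2 x y))
      (integral_rkbs_norm X MM NM (\<lambda>x y. k1 x y - k2 x y)) H N"
    using rkhs_functions.proper_bsf_subset_embedding E by blast
qed

end
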